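(* (1) For any $\alpha\in(0,1)$, $\mathrm{Tr}\,LE_\alpha$ is jointly concave. (2) For any $\alpha>1$, $\mathrm{Tr}\,LE_\alpha$ is not jointly convex on $\mathbb{M}_2^{++}\times\mathbb{M}_2^{++}$.
   Context: Notation: $\mathbb{M}_n^+$ (resp. $\mathbb{M}_n^{++}$) is the set of $n\times n$ complex positive semidefinite (resp. positive definite) matrices. For $A,B\in\mathbb{M}_n^{++}$, $LE_\alpha(A,B):=\exp((1-\alpha)\log A+\alpha\log B)$; for $A,B\in\mathbb{M}_n^+$ (with $s(A)\ge s(B)$ if $\alpha>1$), $LE_\alpha(A,B):=P_0\exp\{(1-\alpha)P_0(\log A)P_0+\alpha P_0(\log B)P_0\}$, where $s(A)$ is the support projection of $A$, $P_0:=s(A)\wedge s(B)$, and $\log A$ is taken on the support of $A$. "$\mathrm{Tr}\,LE_\alpha$ is jointly concave" (for $0<\alpha<1$) means that $(A,B)\mapsto\mathrm{Tr}\,LE_\alpha(A,B)$ is jointly concave on $\mathbb{M}_n^+\times\mathbb{M}_n^+$ for every $n\in\mathbb{N}$; equivalently, on $\mathbb{M}_n^{++}\times\mathbb{M}_n^{++}$ for every $n\in\mathbb{N}$. *)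

theory Defs
  imports "HOL-Analysis.Analysis"
begin

definition adjoint_mat :: "complex ^ 'n ^ 'n \<Rightarrow> complex ^ 'n ^ 'n" where
  "adjoint_mat A = (\<chi> i j. cnj (A $ j $ i))"

definition hermitian :: "complex ^ 'n ^ 'n \<Rightarrow> bool" where
  "hermitian A \<longleftrightarrow> adjoint_mat A = A"

text \<open>The library inner product on \<^typ>\<open>complex ^ 'n\<close> is the real part of the
  Hermitian one; for Hermitian A the form x* A x is real, so nothing is lost.\<close>

definition psd_mats :: "(complex ^ 'n ^ 'n) set" where
  "psd_mats = {A. hermitian A \<and> (\<forall>x. 0 \<le> x \<bullet> (A *v x))}"

definition pd_mats :: "(complex ^ 'n ^ 'n) set" where
  "pd_mats = {A. hermitian A \<and> (\<forall>x. x \<noteq> 0 \<longrightarrow> 0 < x \<bullet> (A *v x))}"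

text \<open>Only meaningful when S is a complex-linear subspace, in which case the
  projection exists and is unique.\<close>

definition orth_proj :: "(complex ^ 'n) set \<Rightarrow> complex ^ 'n ^ 'n" where
  "orth_proj S = (THE P. P ** P = P \<and> hermitian P \<and> range ((*v) P) = S)"

definition support_proj :: "complex ^ 'n ^ 'n \<Rightarrow> complex ^ 'n ^ 'n" where
  "support_proj A = orth_proj (range ((*v) A))"

definition proj_meet :: "complex ^ 'n ^ 'n \<Rightarrow> complex ^ 'n ^ 'n \<Rightarrow> complex ^ 'n ^ 'n" where
  "proj_meet P Q = orth_proj (range ((*v) P) \<inter> range ((*v) Q))"

definition eigenspace :: "complex ^ 'n ^ 'n \<Rightarrow> real \<Rightarrow> (complex ^ 'n) set" where
  "eigenspace A l = {x. A *v x = l *\<^sub>R x}"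

text \<open>Functional calculus for Hermitian matrices, via the spectral decomposition
  (all eigenvalues are real, and there are finitely many of them).\<close>

definition herm_fun :: "(real \<Rightarrow> real) \<Rightarrow> complex ^ 'n ^ 'n \<Rightarrow> complex ^ 'n ^ 'n" where
  "herm_fun f A = (\<Sum>l | eigenspace A l \<noteq> {0}. f l *\<^sub>R orth_proj (eigenspace A l))"

definition mat_exp :: "complex ^ 'n ^ 'n \<Rightarrow> complex ^ 'n ^ 'n" where
  "mat_exp = herm_fun exp"

text \<open>The logarithm is taken on the support and extended by 0 on the kernel.\<close>

definition mat_log :: "complex ^ 'n ^ 'n \<Rightarrow> complex ^ 'n ^ 'n" where
  "mat_log = herm_fun (\<lambda>x. if x = 0 then 0 else ln x)"

definition LE :: "real \<Rightarrow> complex ^ 'n ^ 'n \<Rightarrow> complex ^ 'n ^ 'n \<Rightarrow> complex ^ 'n ^ 'n" where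
  "LE \<alpha> A B =
     (let P = proj_meet (support_proj A) (support_proj B)
      in P ** mat_exp ((1 - \<alpha>) *\<^sub>R (P ** mat_log A ** P) + \<alpha> *\<^sub>R (P ** mat_log B ** P)))"

text \<open>The trace of \<^term>\<open>LE \<alpha> A B\<close> is real for positive semidefinite A and B: the
  exponent vanishes on the kernel of P, so P commutes with the exponential.\<close>

definition Tr_LE :: "real \<Rightarrow> (complex ^ 'n ^ 'n) \<times> (complex ^ 'n ^ 'n) \<Rightarrow> real" where
  "Tr_LE \<alpha> = (\<lambda>(A, B). Re (trace (LE \<alpha> A B)))"

text \<open>On positive definite matrices \<^const>\<open>LE\<close> is the usual log-Euclidean mean.\<close>

lemma orth_proj_UNIV: "orth_proj UNIV = (mat 1 :: complex ^ 'n ^ 'n)"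
  unfolding orth_proj_def
proof (rule the_equality)
  have "range ((*v) (mat 1 :: complex ^ 'n ^ 'n)) = UNIV" by simp
  moreover have "hermitian (mat 1 :: complex ^ 'n ^ 'n)"
    by (simp add: hermitian_def adjoint_mat_def mat_def vec_eq_iff)
  ultimately show "mat 1 ** mat 1 = (mat 1 :: complex ^ 'n ^ 'n) \<and> hermitian (mat 1 :: complex ^ 'n ^ 'n)
      \<and> range ((*v) (mat 1 :: complex ^ 'n ^ 'n)) = UNIV"
    by simp
next
  fix P :: "complex ^ 'n ^ 'n"
  assume P: "P ** P = P \<and> hermitian P \<and> range ((*v) P) = UNIV"
  have "P *v y = y" for y
  proof -
    obtain x where "y = P *v x" using P by (metis UNIV_I imageE)
    then show ?thesis using P by (simp add: matrix_vector_mul_assoc)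
  qed
  then show "P = mat 1" by (simp add: matrix_eq)
qed

lemma support_proj_pd:
  assumes "A \<in> pd_mats" shows "support_proj A = mat 1"
proof -
  have lin: "linear ((*v) A)"
    by (rule linearI)
       (simp_all add: matrix_vector_right_distrib vec_eq_iff matrix_vector_mult_def scaleR_sum_right
         distrib_left sum.distrib)
  have "inj ((*v) A)"
    unfolding linear_injective_0[OF lin]
    using assms by (force simp: pd_mats_def)
  then have "range ((*v) A) = UNIV"
    using linear_injective_imp_surjective[OF lin] by simp
  then show ?thesis by (simp add: support_proj_def orth_proj_UNIV)
qed

lemma LE_pd:
  assumes "A \<in> pd_mats" "B \<in> pd_mats"
  shows "LE \<alpha> A B = mat_exp ((1 - \<alpha>) *\<^sub>R mat_log A + \<alpha> *\<^sub>R mat_log B)"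
proof -
  have "range ((*v) (mat 1 :: complex ^ 'n ^ 'n)) = UNIV" by auto
  then show ?thesis
    by (simp add: LE_def Let_def proj_meet_def support_proj_pd assms orth_proj_UNIV)
qed

text \<open>\<^const>\<open>convex_on\<close> includes convexity of the domain; the positive definite cone is
  convex, so negating \<^const>\<open>convex_on\<close> there negates the inequality.\<close>

lemma convex_pd_mats: "convex (pd_mats :: (complex ^ 'n ^ 'n) set)"
proof (rule convexI)
  fix A B :: "complex ^ 'n ^ 'n" and u v :: real
  assume A: "A \<in> pd_mats" and B: "B \<in> pd_mats" and uv: "0 \<le> u" "0 \<le> v" "u + v = 1"
  have m: "(u *\<^sub>R A + v *\<^sub>R B) *v x = u *\<^sub>R (A *v x) + v *\<^sub>R (B *v x)" for x
    by (simp add: vec_eq_iff matrix_vector_mult_def algebra_simps sum.distrib scaleR_sum_right)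
  have "0 < x \<bullet> ((u *\<^sub>R A + v *\<^sub>R B) *v x)" if "x \<noteq> 0" for x
  proof -
    have "0 < x \<bullet> (A *v x)" "0 < x \<bullet> (B *v x)" using A B that by (auto simp: pd_mats_def)
    then have "0 < u * (x \<bullet> (A *v x)) + v * (x \<bullet> (B *v x))"
      using uv by (cases "u = 0") (auto intro: add_pos_nonneg)
    then show ?thesis by (simp add: m inner_add_right)
  qed
  moreover have "hermitian (u *\<^sub>R A + v *\<^sub>R B)"
    using A B by (auto simp: pd_mats_def hermitian_def adjoint_mat_def vec_eq_iff)
  ultimately show "u *\<^sub>R A + v *\<^sub>R B \<in> pd_mats" by (auto simp: pd_mats_def)
qed

end

theory Submission
  imports Defs "HOL-Real_Asymp.Real_Asymp"
begin

text \<open>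
  Concavity. Let D(X, A) be the trace of X log X - X log A - X + A. By Gibbs' variational principle,
  Tr LE(A, B) is the maximum over X of
  (1 - \<alpha>) (Tr A - D(X, A)) + \<alpha> (Tr B - D(X, B)), attained at X = LE(A, B).
  Hence joint convexity of D gives joint concavity of Tr LE: insert the convex combination of the
  two maximizers. Taylor's formula with integral remainder writes D as an integral over s in (0, 1)
  of s times the squared difference X - A weighted by the inverse of s R_A + (1 - s) L_X, where
  L_X and R_A are left and right multiplication; each integrand is jointly convex, being a supremum
  over W of functions of (X, A) that are linear. Allowing D to be evaluated on singular matrices
  with ker A contained in ker X makes an approximation by definite matrices unnecessary.
  All of this happens in the real Euclidean space underlying \<open>complex ^ 'n\<close>, where the
  real trace of a complex-linear map is twice the real part of the complex one.

  Failure of convexity. Let Q project onto the span of (1, -1), fix A with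
  (1 - \<alpha>) log A = -t Q, and let B be diagonal with entries p and r. As t tends to infinity, Tr LE(A, B)
  tends to (p r) powr (\<alpha> / 2), whose value at the midpoint (5/2, 5/2) of (4, 1) and (1, 4)
  exceeds the common value at those two points.
\<close>

section \<open>Spectral theorem for symmetric maps\<close>

definition orthonormal :: "'a::real_inner set \<Rightarrow> bool" where
  "orthonormal B \<longleftrightarrow> pairwise orthogonal B \<and> (\<forall>b\<in>B. norm b = 1)"

lemma orthonormal_finite:
  fixes B :: "'a::euclidean_space set"
  assumes "orthonormal B" shows "finite B"
  using assms pairwise_orthogonal_imp_finite orthonormal_def by blast

lemma orthonormal_inner:
  assumes "orthonormal B" "b \<in> B" "c \<in> B"
  shows "b \<bullet> c = (if b = c then 1 else 0)"
  using assms by (auto simp: orthonormal_def pairwise_def orthogonal_def norm_eq_1)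

lemma orthonormal_expand:
  fixes B :: "'a::euclidean_space set"
  assumes "orthonormal B" "x \<in> span B"
  shows "(\<Sum>b\<in>B. (x \<bullet> b) *\<^sub>R b) = x"
  using assms orthonormal_finite orthonormal_basis_expand orthonormal_def by blast

lemma parseval:
  fixes B :: "'a::euclidean_space set"
  assumes "orthonormal B" "span B = UNIV"
  shows "(\<Sum>b\<in>B. (x \<bullet> b) * (y \<bullet> b)) = x \<bullet> y"
proof -
  have "x \<bullet> y = (\<Sum>b\<in>B. (x \<bullet> b) *\<^sub>R b) \<bullet> y"
    using orthonormal_expand[OF assms(1), of x] assms(2) by simp
  then show ?thesis by (simp add: inner_sum_left inner_commute[of y])
qed

lemma orthonormal_Basis: "orthonormal (Basis :: 'a::euclidean_space set)"
  by (auto simp: orthonormal_def pairwise_def orthogonal_def inner_Basis)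

text \<open>Expanding in \<open>Basis\<close> moves U and V to their adjoints, and Parseval then
  sums out B. The remaining expression does not mention B, so B may be replaced by
  \<open>Basis\<close>.\<close>

lemma sum_inner_orthonormal:
  fixes U V :: "'a::euclidean_space \<Rightarrow> 'a"
  assumes "linear U" "linear V" and B: "orthonormal B" "span B = UNIV"
  shows "(\<Sum>b\<in>B. U b \<bullet> V b) = (\<Sum>e\<in>Basis. U e \<bullet> V e)"
proof -
  have *: "(\<Sum>b\<in>B. U b \<bullet> V b) = (\<Sum>d\<in>Basis. adjoint U d \<bullet> adjoint V d)"
    if "orthonormal B" "span B = UNIV" for B
  proof -
    have "(\<Sum>b\<in>B. U b \<bullet> V b) = (\<Sum>b\<in>B. \<Sum>d\<in>Basis. (adjoint U d \<bullet> b) * (adjoint V d \<bullet> b))"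
      by (intro sum.cong refl)
         (simp add: euclidean_inner[of "U _"] adjoint_clauses(2) assms inner_commute adjoint_works)
    also have "\<dots> = (\<Sum>d\<in>Basis. adjoint U d \<bullet> adjoint V d)"
      by (subst sum.swap) (simp add: parseval that)
    finally show ?thesis .
  qed
  show ?thesis
    using *[OF B] *[OF orthonormal_Basis] by simp
qed

lemma nonneg_quadratic_linear_coeff:
  fixes p q :: real
  assumes "\<And>t. 0 \<le> 2 * t * p + t\<^sup>2 * q"
  shows "p = 0"
proof (rule ccontr)
  assume p: "p \<noteq> 0"
  \<comment> \<open>The test point t = -p/r, with r exceeding \<open>q / 2\<close>, makes the linear
    term outweigh the quadratic one.\<close>
  define r where "r = \<bar>q\<bar> + 1"
  have r: "r > 0" "q < 2 * r" by (auto simp: r_def)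
  have "2 * (- p / r) * p + (- p / r)\<^sup>2 * q = p\<^sup>2 / r\<^sup>2 * (q - 2 * r)"
    using r by (simp add: field_simps power2_eq_square)
  moreover have "p\<^sup>2 / r\<^sup>2 * (q - 2 * r) < 0"
    using p r by (intro mult_pos_neg) auto
  ultimately show False using assms[of "- p / r"] by linarith
qed

text \<open>A maximizer v of the Rayleigh quotient on the unit sphere of S is an eigenvector:
  \<open>q\<close> is nonnegative on S and vanishes at v, so its first variation at v is
  zero.\<close>

lemma symmetric_eigenvector:
  fixes T :: "'a::euclidean_space \<Rightarrow> 'a"
  assumes T: "linear T" and S: "subspace S" "S \<noteq> {0}" and inv: "\<And>x. x \<in> S \<Longrightarrow> T x \<in> S"
    and sym: "\<And>x y. x \<in> S \<Longrightarrow> y \<in> S \<Longrightarrow> x \<bullet> T y = T x \<bullet> y"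
  obtains v l where "v \<in> S" "norm v = 1" "T v = l *\<^sub>R v"
proof -
  obtain x0 where x0: "x0 \<in> S" "x0 \<noteq> 0" using S subspace_0 by blast
  have "(1 / norm x0) *\<^sub>R x0 \<in> sphere 0 1 \<inter> S"
    using x0 S by (auto simp: subspace_scale)
  then have ne: "sphere 0 1 \<inter> S \<noteq> {}" by blast
  have "compact (sphere 0 1 \<inter> S)"
    using closed_subspace[OF S(1)] by (simp add: compact_Int_closed)
  moreover have "continuous_on (sphere 0 1 \<inter> S) (\<lambda>x. x \<bullet> T x)"
    using T by (intro continuous_intros linear_continuous_on linear_conv_bounded_linear[THEN iffD1])
  ultimately obtain v where v: "v \<in> S" "norm v = 1"
    and max: "\<And>x. x \<in> S \<Longrightarrow> norm x = 1 \<Longrightarrow> x \<bullet> T x \<le> v \<bullet> T v"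
    using continuous_attains_sup[OF _ ne] by fastforce
  define l where "l = v \<bullet> T v"
  define q where "q x = l * (x \<bullet> x) - x \<bullet> T x" for x
  have q: "0 \<le> q x" if "x \<in> S" for x
  proof (cases "x = 0")
    case False
    have "(x /\<^sub>R norm x) \<bullet> T (x /\<^sub>R norm x) \<le> l"
      unfolding l_def using False S that by (intro max) (auto simp: subspace_scale)
    then have "(x \<bullet> T x) / (norm x)\<^sup>2 \<le> l"
      by (simp add: linear_scale[OF T] power2_eq_square field_simps)
    then show ?thesis
      using False by (simp add: q_def divide_le_eq power2_norm_eq_inner)
  qed (simp add: q_def)
  \<comment> \<open>In the direction of the residual w, the first variation of \<open>q\<close> at v
    is twice w \<bullet> w; its vanishing is the eigenvalue equation.\<close>
  define w where "w = l *\<^sub>R v - T v"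
  have w: "w \<in> S" using v inv S by (simp add: w_def subspace_diff subspace_scale)
  have "0 \<le> 2 * t * (w \<bullet> w) + t\<^sup>2 * q w" for t
  proof -
    have "q (v + t *\<^sub>R w) = q v + 2 * t * (l * (v \<bullet> w) - T v \<bullet> w) + t\<^sup>2 * q w"
      using sym[OF v(1) w]
      by (simp add: q_def linear_add[OF T] linear_scale[OF T] inner_add_left inner_add_right
          algebra_simps power2_eq_square inner_commute)
    moreover have "q v = 0" using v by (simp add: q_def l_def norm_eq_1)
    moreover have "l * (v \<bullet> w) - T v \<bullet> w = w \<bullet> w"
      by (simp add: w_def inner_diff_left)
    moreover have "v + t *\<^sub>R w \<in> S" using v w S by (simp add: subspace_add subspace_scale)
    ultimately show ?thesis using q[of "v + t *\<^sub>R w"] by simp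
  qed
  then have "w \<bullet> w = 0" by (rule nonneg_quadratic_linear_coeff)
  then show ?thesis using that[of v l] v by (simp add: w_def)
qed

text \<open>Induction on dimension: symmetry keeps the orthogonal complement of an eigenvector
  invariant. General S, not only the whole space, is wanted later for the range and kernel of a
  projection.\<close>

lemma symmetric_eigenbasis:
  fixes T :: "'a::euclidean_space \<Rightarrow> 'a"
  assumes T: "linear T" and "subspace S" "\<And>x. x \<in> S \<Longrightarrow> T x \<in> S"
    "\<And>x y. x \<in> S \<Longrightarrow> y \<in> S \<Longrightarrow> x \<bullet> T y = T x \<bullet> y"
  shows "\<exists>B. B \<subseteq> S \<and> orthonormal B \<and> span B = S \<and> (\<forall>b\<in>B. \<exists>l. T b = l *\<^sub>R b)"
  using assms(2-4)
proof (induction "dim S" arbitrary: S rule: less_induct)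
  case less
  show ?case
  proof (cases "S = {0}")
    case True
    then show ?thesis by (intro exI[of _ "{}"]) (auto simp: orthonormal_def)
  next
    case False
    obtain v l where v: "v \<in> S" "norm v = 1" "T v = l *\<^sub>R v"
      using symmetric_eigenvector[OF T less.prems(1) False less.prems(2,3)] by blast
    define S' where "S' = {x \<in> S. x \<bullet> v = 0}"
    have S': "subspace S'"
      using less.prems(1) by (auto simp: S'_def subspace_def inner_add_left)
    have "v \<in> S - S'" using v by (auto simp: S'_def)
    then have "S' \<subset> S" unfolding S'_def by blast
    then have "dim S' < dim S"
      using S' less.prems(1) by (metis dim_psubset span_eq_iff)
    moreover have "T x \<in> S'" if "x \<in> S'" for x
      using that less.prems(2) less.prems(3)[of x v] v by (auto simp: S'_def)
    ultimately obtain B where B: "B \<subseteq> S'" "orthonormal B" "span B = S'"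
      "\<forall>b\<in>B. \<exists>l. T b = l *\<^sub>R b"
      using less.hyps[OF _ S'] less.prems(3) unfolding S'_def by fastforce
    have "orthonormal (insert v B)"
      using B(1,2) v by (auto simp: orthonormal_def pairwise_insert orthogonal_def S'_def inner_commute)
    moreover have "span (insert v B) = S"
    proof
      show "span (insert v B) \<subseteq> S"
        using B(1) v(1) less.prems(1) by (intro span_minimal) (auto simp: S'_def)
      show "S \<subseteq> span (insert v B)"
      proof
        fix x assume x: "x \<in> S"
        have "x - (x \<bullet> v) *\<^sub>R v \<in> S'"
          using x v less.prems(1)
          by (auto simp: S'_def inner_diff_left norm_eq_1 subspace_diff subspace_scale)
        then show "x \<in> span (insert v B)" using B(3) span_breakdown_eq by blast
      qed
    qed
    ultimately show ?thesis
      using B v by (intro exI[of _ "insert v B"]) (auto simp: S'_def)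
  qed
qed

section \<open>Joint convexity of the divergence\<close>

text \<open>The Hilbert-Schmidt inner product Tr(U* V) of linear maps, with the trace taken over the
  reals.\<close>

definition hs_inner :: "('a::euclidean_space \<Rightarrow> 'a) \<Rightarrow> ('a \<Rightarrow> 'a) \<Rightarrow> real" where
  "hs_inner U V = (\<Sum>e\<in>Basis. U e \<bullet> V e)"

lemma hs_inner_orthonormal:
  assumes "linear U" "linear V" "orthonormal B" "span B = UNIV"
  shows "hs_inner U V = (\<Sum>b\<in>B. U b \<bullet> V b)"
  unfolding hs_inner_def using sum_inner_orthonormal[OF assms] by simp

lemma hs_inner_add_right: "hs_inner U (\<lambda>z. V z + V' z) = hs_inner U V + hs_inner U V'"
  and hs_inner_scale_right: "hs_inner U (\<lambda>z. r *\<^sub>R V z) = r * hs_inner U V"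
  by (simp_all add: hs_inner_def inner_add_right sum.distrib sum_distrib_left)

text \<open>Packages a spectral decomposition with eigenvalues indexed by basis vectors, so
  multiplicities are counted automatically and trace expressions become sums over B.\<close>

definition nonneg_eigensystem ::
    "('a::euclidean_space \<Rightarrow> 'a) \<Rightarrow> 'a set \<Rightarrow> ('a \<Rightarrow> real) \<Rightarrow> bool" where
  "nonneg_eigensystem T B e \<longleftrightarrow> linear T \<and> orthonormal B \<and> span B = UNIV \<and>
     (\<forall>b\<in>B. T b = e b *\<^sub>R b \<and> 0 \<le> e b)"

lemma nonneg_eigensystemD:
  assumes "nonneg_eigensystem T B e"
  shows "linear T" "orthonormal B" "span B = UNIV" "finite B"
    "\<And>b. b \<in> B \<Longrightarrow> T b = e b *\<^sub>R b" "\<And>b. b \<in> B \<Longrightarrow> 0 \<le> e b"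
  using assms orthonormal_finite by (auto simp: nonneg_eigensystem_def)

lemma eigensystem_inner:
  assumes T: "nonneg_eigensystem T B e" and b: "b \<in> B"
  shows "T z \<bullet> b = e b * (z \<bullet> b)"
proof -
  note D = nonneg_eigensystemD[OF T]
  have "T z = T (\<Sum>c\<in>B. (z \<bullet> c) *\<^sub>R c)"
    using orthonormal_expand[OF D(2), of z] D(3) by simp
  also have "\<dots> = (\<Sum>c\<in>B. (z \<bullet> c) *\<^sub>R e c *\<^sub>R c)"
    by (simp add: linear_sum[OF D(1)] linear_scale[OF D(1)] D(5))
  finally have "T z \<bullet> b = (\<Sum>c\<in>B. (z \<bullet> c) * (e c * (if c = b then 1 else 0)))"
    by (simp add: inner_sum_left orthonormal_inner[OF D(2) _ b] mult.assoc)
  also have "\<dots> = e b * (z \<bullet> b)"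
    using b D(4) by (simp add: if_distrib[of "(*) _"] sum.delta' cong: if_cong)
  finally show ?thesis .
qed

text \<open>For 0 < s < 1 the denominator vanishes only if both eigenvalues are 0; the junk value
  0 / 0 = 0 is then the right one.\<close>

definition quasi_entropy ::
    "real \<Rightarrow> 'a::euclidean_space set \<Rightarrow> ('a \<Rightarrow> real) \<Rightarrow> 'a set \<Rightarrow> ('a \<Rightarrow> real) \<Rightarrow> real" where
  "quasi_entropy s B x C a =
     (\<Sum>b\<in>B. \<Sum>c\<in>C. (b \<bullet> c)\<^sup>2 * (s * (x b - a c)\<^sup>2 / (s * a c + (1 - s) * x b)))"

text \<open>Linear in X and A for fixed W; the supremum over W is the quasi-entropy divided by s.\<close>

definition dual_form ::
    "real \<Rightarrow> ('a::euclidean_space \<Rightarrow> 'a) \<Rightarrow> ('a \<Rightarrow> 'a) \<Rightarrow> ('a \<Rightarrow> 'a) \<Rightarrow> real" where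
  "dual_form s W X A = 2 * hs_inner W X - 2 * hs_inner W A
     - (1 - s) * hs_inner W (X \<circ> W) - s * hs_inner W (W \<circ> A)"

text \<open>Left multiplication by X and right multiplication by A are simultaneously diagonal in
  the coordinates \<open>W c \<bullet> b\<close>. The form therefore splits into scalar quadratics,
  one for each pair (b, c).\<close>

lemma dual_form_coordinates:
  assumes W: "linear W" and X: "nonneg_eigensystem X B x" and A: "nonneg_eigensystem A C a"
  shows "dual_form s W X A = (\<Sum>b\<in>B. \<Sum>c\<in>C. 2 * (W c \<bullet> b) * (b \<bullet> c) * (x b - a c)
     - (s * a c + (1 - s) * x b) * (W c \<bullet> b)\<^sup>2)"
proof -
  note DX = nonneg_eigensystemD[OF X] and DA = nonneg_eigensystemD[OF A]
  have pars: "y \<bullet> z = (\<Sum>b\<in>B. (y \<bullet> b) * (z \<bullet> b))" for y z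
    by (simp add: parseval[OF DX(2,3)])
  have hs: "hs_inner W V = (\<Sum>b\<in>B. \<Sum>c\<in>C. (W c \<bullet> b) * (V c \<bullet> b))" if "linear V" for V
    by (subst sum.swap) (simp add: hs_inner_orthonormal[OF W that DA(2,3)] pars[symmetric])
  have "hs_inner W X = (\<Sum>b\<in>B. \<Sum>c\<in>C. (W c \<bullet> b) * (x b * (c \<bullet> b)))"
    by (auto simp: hs DX(1) eigensystem_inner[OF X] intro!: sum.cong)
  moreover have "hs_inner W A = (\<Sum>b\<in>B. \<Sum>c\<in>C. (W c \<bullet> b) * (a c * (c \<bullet> b)))"
    by (auto simp: hs DA(1) DA(5) intro!: sum.cong)
  moreover have "hs_inner W (X \<circ> W) = (\<Sum>b\<in>B. \<Sum>c\<in>C. (W c \<bullet> b) * (x b * (W c \<bullet> b)))"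
    by (auto simp: hs DX(1) W linear_compose eigensystem_inner[OF X] intro!: sum.cong)
  moreover have "hs_inner W (W \<circ> A) = (\<Sum>b\<in>B. \<Sum>c\<in>C. (W c \<bullet> b) * (a c * (W c \<bullet> b)))"
    by (auto simp: hs DA(1,5) W linear_compose linear_scale[OF W] intro!: sum.cong)
  moreover have "(\<Sum>b\<in>B. \<Sum>c\<in>C. 2 * (W c \<bullet> b) * (b \<bullet> c) * (x b - a c)
       - (s * a c + (1 - s) * x b) * (W c \<bullet> b)\<^sup>2) =
      (\<Sum>b\<in>B. \<Sum>c\<in>C. 2 * ((W c \<bullet> b) * (x b * (c \<bullet> b))) - 2 * ((W c \<bullet> b) * (a c * (c \<bullet> b)))
       - (1 - s) * ((W c \<bullet> b) * (x b * (W c \<bullet> b))) - s * ((W c \<bullet> b) * (a c * (W c \<bullet> b))))"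
    by (intro sum.cong refl) (simp add: algebra_simps power2_eq_square inner_commute)
  ultimately show ?thesis
    by (simp only: dual_form_def sum_subtractf flip: sum_distrib_left)
qed

text \<open>The gap is (D w - k (p - q))^2 / D with D the denominator. If D = 0, then p and q vanish
  and both sides are 0.\<close>

lemma complete_square_le:
  fixes p q w k s :: real
  assumes "0 \<le> p" "0 \<le> q" "0 < s" "s < 1"
  shows "2 * w * k * (p - q) - (s * q + (1 - s) * p) * w\<^sup>2
      \<le> k\<^sup>2 * ((p - q)\<^sup>2 / (s * q + (1 - s) * p))"
proof (cases "s * q + (1 - s) * p = 0")
  case True
  then have "p = 0" "q = 0" using assms by (auto simp: add_nonneg_eq_0_iff)
  then show ?thesis by simp
next
  case False
  define D where "D = s * q + (1 - s) * p"
  have D: "D > 0" using False assms by (simp add: D_def order_less_le)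
  have "0 \<le> (D * w - k * (p - q))\<^sup>2 / D" using D by simp
  also have "\<dots> = D * w\<^sup>2 - 2 * w * k * (p - q) + k\<^sup>2 * ((p - q)\<^sup>2 / D)"
    using D by (simp add: field_simps power2_eq_square)
  finally show ?thesis by (simp add: D_def)
qed

text \<open>Here w is the vertex of the quadratic. If the denominator is 0, division by zero yields
  w = 0 and both sides are 0.\<close>

lemma complete_square_eq:
  fixes p q k s :: real
  assumes "0 \<le> p" "0 \<le> q" "0 < s" "s < 1"
  defines "w \<equiv> k * (p - q) / (s * q + (1 - s) * p)"
  shows "2 * w * k * (p - q) - (s * q + (1 - s) * p) * w\<^sup>2
      = k\<^sup>2 * ((p - q)\<^sup>2 / (s * q + (1 - s) * p))"
  unfolding w_def by (cases "s * q + (1 - s) * p = 0") (auto simp: divide_simps power2_eq_square)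

lemma dual_form_le:
  assumes "linear W" and X: "nonneg_eigensystem X B x" and A: "nonneg_eigensystem A C a"
    and s: "0 < s" "s < 1"
  shows "s * dual_form s W X A \<le> quasi_entropy s B x C a"
proof -
  have "dual_form s W X A \<le>
      (\<Sum>b\<in>B. \<Sum>c\<in>C. (b \<bullet> c)\<^sup>2 * ((x b - a c)\<^sup>2 / (s * a c + (1 - s) * x b)))"
    unfolding dual_form_coordinates[OF assms(1-3)]
    by (intro sum_mono complete_square_le nonneg_eigensystemD(6)[OF X] nonneg_eigensystemD(6)[OF A] s)
  then have "s * dual_form s W X A \<le>
      s * (\<Sum>b\<in>B. \<Sum>c\<in>C. (b \<bullet> c)\<^sup>2 * ((x b - a c)\<^sup>2 / (s * a c + (1 - s) * x b)))"
    using s by simp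
  then show ?thesis by (simp add: quasi_entropy_def sum_distrib_left mult_ac)
qed

text \<open>The scalar quadratics involve independent coordinates of W, so prescribing its values on
  C realizes all their vertices \<open>w b c\<close> at once.\<close>

lemma dual_form_attained:
  assumes X: "nonneg_eigensystem X B x" and A: "nonneg_eigensystem A C a"
    and s: "0 < s" "s < 1"
  obtains W where "linear W" "s * dual_form s W X A = quasi_entropy s B x C a"
proof -
  note DX = nonneg_eigensystemD[OF X] and DA = nonneg_eigensystemD[OF A]
  define w where "w b c = (b \<bullet> c) * (x b - a c) / (s * a c + (1 - s) * x b)" for b c
  define k where "k c = (\<Sum>b\<in>B. w b c *\<^sub>R b)" for c
  define W where "W z = (\<Sum>c\<in>C. (z \<bullet> c) *\<^sub>R k c)" for z
  have W: "linear W"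
    by (rule linearI)
       (simp_all add: W_def inner_add_left scaleR_add_left sum.distrib scaleR_right.sum)
  have wbc: "W c \<bullet> b = w b c" if "b \<in> B" "c \<in> C" for b c
  proof -
    have "W c = k c"
      using that DA(4)
      by (simp add: W_def orthonormal_inner[OF DA(2)] if_distrib[of "\<lambda>t. t *\<^sub>R _"] sum.delta cong: if_cong)
    then show ?thesis
      using that DX(4) by (simp add: k_def inner_sum_left orthonormal_inner[OF DX(2)] sum.delta' if_distrib[of "(*) _"] cong: if_cong)
  qed
  have "dual_form s W X A =
      (\<Sum>b\<in>B. \<Sum>c\<in>C. (b \<bullet> c)\<^sup>2 * ((x b - a c)\<^sup>2 / (s * a c + (1 - s) * x b)))"
    unfolding dual_form_coordinates[OF W X A]
    by (intro sum.cong refl) (simp only: wbc w_def complete_square_eq[OF DX(6) DA(6) s])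
  then have "s * dual_form s W X A = quasi_entropy s B x C a"
    by (simp add: quasi_entropy_def sum_distrib_left mult_ac)
  then show ?thesis using that W by blast
qed

lemma dual_form_linear:
  assumes "linear W"
  shows "dual_form s W (\<lambda>z. u *\<^sub>R X1 z + v *\<^sub>R X2 z) (\<lambda>z. u *\<^sub>R A1 z + v *\<^sub>R A2 z)
    = u * dual_form s W X1 A1 + v * dual_form s W X2 A2"
  by (simp add: dual_form_def o_def linear_add[OF assms] linear_scale[OF assms]
      hs_inner_add_right hs_inner_scale_right algebra_simps)

text \<open>The W that is optimal for the combination is admissible at both endpoints; linearity of
  \<open>dual_form\<close> in (X, A) splits the value, and each part is at most the corresponding
  supremum.\<close>

lemma quasi_entropy_jointly_convex:
  assumes "nonneg_eigensystem X1 B1 x1" "nonneg_eigensystem X2 B2 x2"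
    and "nonneg_eigensystem A1 C1 a1" "nonneg_eigensystem A2 C2 a2"
    and "nonneg_eigensystem (\<lambda>z. u *\<^sub>R X1 z + v *\<^sub>R X2 z) B x"
    and "nonneg_eigensystem (\<lambda>z. u *\<^sub>R A1 z + v *\<^sub>R A2 z) C a"
    and "0 \<le> u" "0 \<le> v" and s: "0 < s" "s < 1"
  shows "quasi_entropy s B x C a \<le> u * quasi_entropy s B1 x1 C1 a1 + v * quasi_entropy s B2 x2 C2 a2"
proof -
  obtain W where W: "linear W" and
    "s * dual_form s W (\<lambda>z. u *\<^sub>R X1 z + v *\<^sub>R X2 z) (\<lambda>z. u *\<^sub>R A1 z + v *\<^sub>R A2 z)
      = quasi_entropy s B x C a"
    using dual_form_attained[OF assms(5,6) s] by blast
  then have "quasi_entropy s B x C a = u * (s * dual_form s W X1 A1) + v * (s * dual_form s W X2 A2)"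
    by (simp add: dual_form_linear[OF W] algebra_simps)
  also have "\<dots> \<le> u * quasi_entropy s B1 x1 C1 a1 + v * quasi_entropy s B2 x2 C2 a2"
    by (intro add_mono mult_left_mono dual_form_le W assms)
  finally show ?thesis .
qed

section \<open>The scalar divergence and its integral representation\<close>

text \<open>The Bregman divergence of x ln x. Since ln 0 = 0, it equals a at x = 0, but for x > 0
  and a = 0 its value is junk in place of infinity.\<close>

definition bregman :: "real \<Rightarrow> real \<Rightarrow> real" where
  "bregman x a = x * ln x - x * ln a - x + a"

lemma bregman_nonneg:
  assumes "0 \<le> x" "0 \<le> a" "a = 0 \<Longrightarrow> x = 0"
  shows "0 \<le> bregman x a"
proof (cases "x = 0")
  case False
  then have "x > 0" "a \<noteq> 0" using assms(1,3) by auto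
  then have pos: "0 < x" "0 < a" using assms(2) by simp_all
  then have "x * ln (a / x) \<le> x * (a / x - 1)" by (intro mult_left_mono ln_le_minus_one) auto
  then show ?thesis using pos by (simp add: bregman_def ln_div algebra_simps)
qed (use assms(2) in \<open>simp add: bregman_def\<close>)

lemma bregman_integral:
  assumes "0 \<le> x" "0 \<le> a" "a = 0 \<Longrightarrow> x = 0"
  shows "((\<lambda>s. s * (x - a)\<^sup>2 / (s * a + (1 - s) * x)) has_integral bregman x a) {0<..<1}"
proof (cases "x = 0")
  case True
  \<comment> \<open>For x = 0 the integrand is constantly a on the open interval, also for a = 0
    because 0 / 0 = 0. Treating this case apart keeps the logarithm below away from its singularity
    at s = 0.\<close>
  have "((\<lambda>s::real. a) has_integral a) {0<..<1}"
    using has_integral_const_real[of a 0 1] by (simp add: has_integral_Icc_iff_Ioo)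
  moreover have "a = s * (x - a)\<^sup>2 / (s * a + (1 - s) * x)" if "s \<in> {0<..<1}" for s
    using True that by (simp add: power2_eq_square)
  ultimately have "((\<lambda>s. s * (x - a)\<^sup>2 / (s * a + (1 - s) * x)) has_integral a) {0<..<1}"
    by (rule has_integral_eq[rotated])
  then show ?thesis using True by (simp add: bregman_def)
next
  case False
  then have "x > 0" "a \<noteq> 0" using assms(1,3) by auto
  then have pos: "0 < x" "0 < a" using assms(2) by simp_all
  have D: "0 < s * a + (1 - s) * x" if "0 \<le> s" "s \<le> 1" for s
    using that pos by (cases "s = 0") (auto intro: add_pos_nonneg)
  have deriv: "((\<lambda>s. (a - x) * s - x * ln (s * a + (1 - s) * x)) has_real_derivative
      (a - x) - x * ((a - x) / (s * a + (1 - s) * x))) (at s within {0..1})" if "0 \<le> s" "s \<le> 1" for s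
    using D[OF that] by (auto intro!: derivative_eq_intros)
  have "((\<lambda>s. (a - x) - x * ((a - x) / (s * a + (1 - s) * x))) has_integral
      ((a - x) * 1 - x * ln (1 * a + (1 - 1) * x)) - ((a - x) * 0 - x * ln (0 * a + (1 - 0) * x))) {0..1}"
    by (rule fundamental_theorem_of_calculus)
       (use deriv in \<open>auto simp flip: has_real_derivative_iff_has_vector_derivative\<close>)
  then have "((\<lambda>s. (a - x) - x * ((a - x) / (s * a + (1 - s) * x))) has_integral bregman x a) {0<..<1}"
    by (simp add: bregman_def has_integral_Icc_iff_Ioo algebra_simps)
  moreover have "(a - x) - x * ((a - x) / (s * a + (1 - s) * x)) =
      s * (x - a)\<^sup>2 / (s * a + (1 - s) * x)" if "s \<in> {0<..<1}" for s
  proof -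
    define d where "d = s * a + (1 - s) * x"
    have "d > 0" using D[of s] that by (simp add: d_def)
    then have "(a - x) - x * ((a - x) / d) = ((a - x) * d - x * (a - x)) / d"
      by (simp add: field_simps)
    \<comment> \<open>The key factorization is d - x = s (a - x).\<close>
    also have "(a - x) * d - x * (a - x) = s * (x - a)\<^sup>2"
      by (simp add: d_def power2_eq_square algebra_simps)
    finally show ?thesis by (simp add: d_def)
  qed
  ultimately show ?thesis by (rule has_integral_eq[rotated])
qed

section \<open>The divergence of positive maps\<close>

definition divergence ::
    "'a::euclidean_space set \<Rightarrow> ('a \<Rightarrow> real) \<Rightarrow> 'a set \<Rightarrow> ('a \<Rightarrow> real) \<Rightarrow> real" where
  "divergence B x C a = (\<Sum>b\<in>B. \<Sum>c\<in>C. (b \<bullet> c)\<^sup>2 * bregman (x b) (a c))"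

text \<open>Pairs with \<open>a c = 0\<close> and \<open>x b\<close> nonzero are those where
  \<open>bregman\<close> is junk; the kernel inclusion gives them weight zero.\<close>

lemma orthogonal_off_support:
  assumes X: "nonneg_eigensystem X B x" and A: "nonneg_eigensystem A C a"
    and ker: "\<And>z. A z = 0 \<Longrightarrow> X z = 0" and "b \<in> B" "c \<in> C" "a c = 0"
  shows "x b = 0 \<or> b \<bullet> c = 0"
proof -
  have "A c = 0" using nonneg_eigensystemD(5)[OF A] assms by simp
  then have "X c \<bullet> b = 0" using ker by simp
  then show ?thesis using eigensystem_inner[OF X \<open>b \<in> B\<close>] by (simp add: inner_commute)
qed

lemma divergence_nonneg:
  assumes X: "nonneg_eigensystem X B x" and A: "nonneg_eigensystem A C a"
    and ker: "\<And>z. A z = 0 \<Longrightarrow> X z = 0"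
  shows "0 \<le> divergence B x C a"
  unfolding divergence_def
proof (intro sum_nonneg)
  fix b c assume "b \<in> B" "c \<in> C"
  then show "0 \<le> (b \<bullet> c)\<^sup>2 * bregman (x b) (a c)"
    using orthogonal_off_support[OF X A ker, of b c]
      nonneg_eigensystemD(6)[OF X, of b] nonneg_eigensystemD(6)[OF A, of c]
    by (cases "b \<bullet> c = 0") (auto intro!: mult_nonneg_nonneg bregman_nonneg)
qed

lemma divergence_self:
  assumes "nonneg_eigensystem X B x"
  shows "divergence B x B x = 0"
  unfolding divergence_def using nonneg_eigensystemD(2)[OF assms]
  by (auto intro!: sum.neutral simp: orthonormal_inner bregman_def)

lemma divergence_integral:
  assumes X: "nonneg_eigensystem X B x" and A: "nonneg_eigensystem A C a"
    and ker: "\<And>z. A z = 0 \<Longrightarrow> X z = 0"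
  shows "((\<lambda>s. quasi_entropy s B x C a) has_integral divergence B x C a) {0<..<1}"
  unfolding divergence_def quasi_entropy_def
proof (intro has_integral_sum nonneg_eigensystemD(4)[OF X] nonneg_eigensystemD(4)[OF A])
  fix b c assume bc: "b \<in> B" "c \<in> C"
  show "((\<lambda>s. (b \<bullet> c)\<^sup>2 * (s * (x b - a c)\<^sup>2 / (s * a c + (1 - s) * x b))) has_integral
      (b \<bullet> c)\<^sup>2 * bregman (x b) (a c)) {0<..<1}"
  proof (cases "b \<bullet> c = 0")
    case False
    then have "a c = 0 \<Longrightarrow> x b = 0" using orthogonal_off_support[OF X A ker bc] by blast
    then show ?thesis
      using bc by (intro has_integral_mult_right bregman_integral
          nonneg_eigensystemD(6)[OF X] nonneg_eigensystemD(6)[OF A])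
  qed simp
qed

text \<open>Integrates the inequality for quasi-entropies over s. The kernel inclusions supply the
  integral representation for both endpoints and for the combination.\<close>

lemma divergence_jointly_convex:
  assumes X1: "nonneg_eigensystem X1 B1 x1" and X2: "nonneg_eigensystem X2 B2 x2"
    and A1: "nonneg_eigensystem A1 C1 a1" and A2: "nonneg_eigensystem A2 C2 a2"
    and X: "nonneg_eigensystem (\<lambda>z. u *\<^sub>R X1 z + v *\<^sub>R X2 z) B x"
    and A: "nonneg_eigensystem (\<lambda>z. u *\<^sub>R A1 z + v *\<^sub>R A2 z) C a"
    and ker1: "\<And>z. A1 z = 0 \<Longrightarrow> X1 z = 0" and ker2: "\<And>z. A2 z = 0 \<Longrightarrow> X2 z = 0"
    and ker: "\<And>z. u *\<^sub>R A1 z + v *\<^sub>R A2 z = 0 \<Longrightarrow> u *\<^sub>R X1 z + v *\<^sub>R X2 z = 0"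
    and uv: "0 \<le> u" "0 \<le> v"
  shows "divergence B x C a \<le> u * divergence B1 x1 C1 a1 + v * divergence B2 x2 C2 a2"
proof (rule has_integral_le)
  show "((\<lambda>s. quasi_entropy s B x C a) has_integral divergence B x C a) {0<..<1}"
    by (rule divergence_integral[OF X A ker])
  show "((\<lambda>s. u * quasi_entropy s B1 x1 C1 a1 + v * quasi_entropy s B2 x2 C2 a2) has_integral
      u * divergence B1 x1 C1 a1 + v * divergence B2 x2 C2 a2) {0<..<1}"
    by (intro has_integral_add has_integral_mult_right
        divergence_integral[OF X1 A1 ker1] divergence_integral[OF X2 A2 ker2])
qed (auto intro!: quasi_entropy_jointly_convex[OF X1 X2 A1 A2 X A uv])

text \<open>By Parseval the weights (b \<bullet> c)^2 are doubly stochastic, so terms depending on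
  only one index collapse. L plays the role of log A, extended by 0 to the kernel since ln 0 = 0;
  keeping it abstract also covers \<open>LE_exponent\<close>.\<close>

lemma divergence_trace:
  assumes X: "nonneg_eigensystem X B x" and A: "nonneg_eigensystem A C a"
    and L: "linear L" "\<And>c. c \<in> C \<Longrightarrow> L c = ln (a c) *\<^sub>R c"
  shows "divergence B x C a =
    (\<Sum>b\<in>B. x b * ln (x b)) - hs_inner X L - hs_inner (\<lambda>z. z) X + hs_inner (\<lambda>z. z) A"
proof -
  note DX = nonneg_eigensystemD[OF X] and DA = nonneg_eigensystemD[OF A]
  have sq: "(\<Sum>c\<in>C. (b \<bullet> c)\<^sup>2) = 1" if "b \<in> B" for b
    using parseval[OF DA(2,3), of b b] orthonormal_inner[OF DX(2) that that]
    by (simp add: power2_eq_square)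
  have sq': "(\<Sum>b\<in>B. (b \<bullet> c)\<^sup>2) = 1" if "c \<in> C" for c
    using parseval[OF DX(2,3), of c c] orthonormal_inner[OF DA(2) that that]
    by (simp add: power2_eq_square inner_commute)
  have fst: "(\<Sum>b\<in>B. \<Sum>c\<in>C. (b \<bullet> c)\<^sup>2 * f b) = (\<Sum>b\<in>B. f b)" for f :: "_ \<Rightarrow> real"
    by (simp add: sq flip: sum_distrib_right)
  have snd: "(\<Sum>b\<in>B. \<Sum>c\<in>C. (b \<bullet> c)\<^sup>2 * f c) = (\<Sum>c\<in>C. f c)" for f :: "_ \<Rightarrow> real"
    by (subst sum.swap) (simp add: sq' flip: sum_distrib_right)
  have "hs_inner X L = (\<Sum>c\<in>C. X c \<bullet> L c)"
    by (rule hs_inner_orthonormal[OF DX(1) L(1) DA(2,3)])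
  also have "\<dots> = (\<Sum>c\<in>C. ln (a c) * (\<Sum>b\<in>B. (X c \<bullet> b) * (c \<bullet> b)))"
    by (simp add: L(2) parseval[OF DX(2,3)])
  also have "\<dots> = (\<Sum>c\<in>C. \<Sum>b\<in>B. (c \<bullet> b)\<^sup>2 * (x b * ln (a c)))"
    by (auto simp: eigensystem_inner[OF X] sum_distrib_left power2_eq_square mult_ac intro!: sum.cong)
  also have "\<dots> = (\<Sum>b\<in>B. \<Sum>c\<in>C. (b \<bullet> c)\<^sup>2 * (x b * ln (a c)))"
    by (subst sum.swap) (simp add: inner_commute)
  finally have XL: "hs_inner X L = (\<Sum>b\<in>B. \<Sum>c\<in>C. (b \<bullet> c)\<^sup>2 * (x b * ln (a c)))" .
  have "hs_inner (\<lambda>z. z) X = (\<Sum>b\<in>B. x b)"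
    using hs_inner_orthonormal[OF linear_id DX(1-3)] DX(5) orthonormal_inner[OF DX(2)]
    by (simp add: id_def)
  moreover have "hs_inner (\<lambda>z. z) A = (\<Sum>c\<in>C. a c)"
    using hs_inner_orthonormal[OF linear_id DA(1-3)] DA(5) orthonormal_inner[OF DA(2)]
    by (simp add: id_def)
  moreover have "divergence B x C a = (\<Sum>b\<in>B. \<Sum>c\<in>C. (b \<bullet> c)\<^sup>2 * (x b * ln (x b)))
     - (\<Sum>b\<in>B. \<Sum>c\<in>C. (b \<bullet> c)\<^sup>2 * (x b * ln (a c))) - (\<Sum>b\<in>B. \<Sum>c\<in>C. (b \<bullet> c)\<^sup>2 * x b)
     + (\<Sum>b\<in>B. \<Sum>c\<in>C. (b \<bullet> c)\<^sup>2 * a c)"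
    by (simp add: divergence_def bregman_def algebra_simps sum.distrib sum_subtractf)
  ultimately show ?thesis unfolding XL fst snd by simp
qed

section \<open>Functional calculus of Hermitian matrices\<close>

lemma linear_matrix_vector [simp]: "linear ((*v) (A :: complex ^ 'n ^ 'm))"
  by (rule linearI)
     (simp_all add: matrix_vector_right_distrib vec_eq_iff matrix_vector_mult_def scaleR_right.sum
       distrib_left sum.distrib)

lemma scaleR_matrix_vector: "(r *\<^sub>R A) *v x = r *\<^sub>R (A *v x)" for A :: "complex ^ 'n ^ 'm"
  by (simp add: vec_eq_iff matrix_vector_mult_def scaleR_right.sum)

lemma matrix_vector_scaleR: "A *v (r *\<^sub>R x) = r *\<^sub>R (A *v x)" for A :: "complex ^ 'n ^ 'm"
  by (rule linear_scale[OF linear_matrix_vector])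

lemma sum_matrix_vector: "(\<Sum>i\<in>I. M i) *v x = (\<Sum>i\<in>I. M i *v x)" for M :: "'i \<Rightarrow> complex ^ 'n ^ 'm"
  by (induction I rule: infinite_finite_induct) (simp_all add: matrix_vector_mult_add_rdistrib)

lemma inner_complex_mult_right: "x \<bullet> (a * y) = (cnj a * x) \<bullet> y" for x y a :: complex
  by (simp add: inner_complex_def algebra_simps)

lemma inner_smult_left: "(c *s x) \<bullet> y = x \<bullet> (cnj c *s y)" for x y :: "complex ^ 'n"
  by (simp add: inner_vec_def inner_complex_def algebra_simps)

lemma inner_adjoint_mat: "x \<bullet> (A *v y) = (adjoint_mat A *v x) \<bullet> y" for A :: "complex ^ 'n ^ 'n"
proof -
  have "x \<bullet> (A *v y) = (\<Sum>i\<in>UNIV. \<Sum>j\<in>UNIV. (cnj (A $ i $ j) * x $ i) \<bullet> y $ j)"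
    unfolding inner_vec_def matrix_vector_mult_def
    by (simp add: inner_sum_right) (intro sum.cong refl inner_complex_mult_right)
  also have "\<dots> = (adjoint_mat A *v x) \<bullet> y"
    by (subst sum.swap) (simp add: inner_vec_def matrix_vector_mult_def inner_sum_left adjoint_mat_def)
  finally show ?thesis .
qed

text \<open>The conjugate transpose is the adjoint for the real inner product too, and that inner
  product is nondegenerate; this is what lets the real spectral theorem apply.\<close>

lemma hermitian_iff_symmetric: "hermitian A \<longleftrightarrow> (\<forall>x y. x \<bullet> (A *v y) = (A *v x) \<bullet> y)"
proof
  assume "\<forall>x y. x \<bullet> (A *v y) = (A *v x) \<bullet> y"
  then have "adjoint_mat A *v x = A *v x" for x
    by (metis inner_adjoint_mat vector_eq_rdot)
  then show "hermitian A" by (simp add: hermitian_def matrix_eq)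
qed (simp add: inner_adjoint_mat hermitian_def)

lemma hermitian_inner: "hermitian A \<Longrightarrow> (A *v x) \<bullet> y = x \<bullet> (A *v y)"
  by (simp add: hermitian_iff_symmetric)

lemma hermitian_zero: "hermitian 0"
  and hermitian_add: "hermitian A \<Longrightarrow> hermitian B \<Longrightarrow> hermitian (A + B)"
  and hermitian_scaleR: "hermitian A \<Longrightarrow> hermitian (r *\<^sub>R A)"
  by (simp_all add: hermitian_def adjoint_mat_def vec_eq_iff)

lemma hermitian_sum: "(\<And>i. i \<in> I \<Longrightarrow> hermitian (M i)) \<Longrightarrow> hermitian (\<Sum>i\<in>I. M i)"
  by (induction I rule: infinite_finite_induct) (auto intro: hermitian_zero hermitian_add)

lemma hermitian_conjugate: "hermitian P \<Longrightarrow> hermitian A \<Longrightarrow> hermitian (P ** A ** P)"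
  by (simp add: hermitian_iff_symmetric matrix_vector_mul_assoc[symmetric])

section \<open>Orthogonal projections onto complex subspaces\<close>

lemma real_subspace_of_complex:
  fixes S :: "(complex ^ 'n) set"
  assumes "vec.subspace S" shows "subspace S"
proof -
  have "r *\<^sub>R x = complex_of_real r *s x" for r and x :: "complex ^ 'n"
    by (simp add: vec_eq_iff scaleR_conv_of_real[where 'a = complex])
  then show ?thesis using assms by (auto simp: subspace_def vec.subspace_def)
qed

lemma orth_proj_unique:
  assumes "P ** P = P" "hermitian P" "range ((*v) P) = S"
    and "y \<in> S" "\<And>w. w \<in> S \<Longrightarrow> (x - y) \<bullet> w = 0"
  shows "P *v x = y"
proof -
  have P: "P *v x \<in> S" "P *v y = y"
    using assms(1,3,4) by (auto simp: matrix_vector_mul_assoc)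
  have "(x - P *v x) \<bullet> (P *v z) = 0" for z
    using assms(1) by (simp add: hermitian_inner[OF assms(2)] inner_diff_left matrix_vector_mul_assoc)
  moreover have "(x - y) \<bullet> (P *v z) = 0" for z
    using assms(3,5) by blast
  ultimately have "(P *v x - y) \<bullet> (P *v z) = 0" for z
    by (simp add: inner_diff_left)
  \<comment> \<open>P maps x - y to P x - y, so this vector is orthogonal to itself.\<close>
  from this[of "x - y"] show ?thesis
    using P(2) by (simp add: matrix_vector_mult_diff_distrib)
qed

text \<open>A real orthonormal basis of S yields a projection that is a priori only real-linear.
  Complex homogeneity follows from uniqueness of the point of S whose difference from x is
  orthogonal to S.\<close>

lemma orth_proj_exists:
  fixes S :: "(complex ^ 'n) set"
  assumes S: "vec.subspace S"
  shows "\<exists>P. P ** P = P \<and> hermitian P \<and> range ((*v) P) = S"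
proof -
  \<comment> \<open>Every vector is an eigenvector of the zero map, so the spectral theorem provides
    a plain orthonormal basis of S.\<close>
  obtain B where B: "B \<subseteq> S" "orthonormal B" "span B = S"
    using symmetric_eigenbasis[OF linear_zero real_subspace_of_complex[OF S]]
      subspace_0[OF real_subspace_of_complex[OF S]] by auto
  define p where "p x = (\<Sum>b\<in>B. (x \<bullet> b) *\<^sub>R b)" for x
  have pS: "p x \<in> S" for x
    unfolding p_def B(3)[symmetric] by (intro span_sum span_scale span_base)
  have p_id: "p x = x" if "x \<in> S" for x
    unfolding p_def using orthonormal_expand[OF B(2)] B(3) that by simp
  have p_sym: "p x \<bullet> y = x \<bullet> p y" for x y
    by (simp add: p_def inner_sum_left inner_sum_right inner_commute[of _ y] mult.commute)
  have p_orth: "(x - p x) \<bullet> w = 0" if "w \<in> S" for x w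
    using p_sym[of x w] p_id[OF that] by (simp add: inner_diff_left)
  have p_unique: "p x = y" if y: "y \<in> S" "\<And>w. w \<in> S \<Longrightarrow> (x - y) \<bullet> w = 0" for x y
  proof -
    have "p x - y \<in> S"
      by (rule subspace_diff[OF real_subspace_of_complex[OF S] pS y(1)])
    then have "(p x - y) \<bullet> (p x - y) = 0"
      using p_orth[of "p x - y" x] y(2)[of "p x - y"] by (simp add: inner_diff_left)
    then show ?thesis by simp
  qed
  have p_add: "p (x + y) = p x + p y" for x y
    by (simp add: p_def inner_add_left scaleR_add_left sum.distrib)
  have p_scale: "p (c *s x) = c *s p x" for c x
  proof -
    have "c *s p x \<in> S" using S pS by (simp add: vec.subspace_scale)
    moreover have "(c *s x - c *s p x) \<bullet> w = 0" if "w \<in> S" for w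
    proof -
      have "(c *s x - c *s p x) \<bullet> w = (x - p x) \<bullet> (cnj c *s w)"
        unfolding vec.scale_right_diff_distrib[symmetric] by (rule inner_smult_left)
      then show ?thesis using p_orth vec.subspace_scale[OF S that] by simp
    qed
    ultimately show ?thesis by (rule p_unique)
  qed
  have "Vector_Spaces.linear (*s) (*s) p"
    by (simp add: Vector_Spaces.linear_iff vec.vector_space_axioms p_add p_scale)
  then have P: "matrix p *v x = p x" for x by (rule matrix_works)
  have "matrix p ** matrix p = matrix p"
    by (simp add: matrix_eq P p_id pS flip: matrix_vector_mul_assoc)
  moreover have "hermitian (matrix p)" by (simp add: hermitian_iff_symmetric P p_sym)
  moreover have "range ((*v) (matrix p)) = S" unfolding P
    using pS p_id by (metis image_subset_iff rangeI subsetI subset_antisym)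
  ultimately show ?thesis by blast
qed

lemma orth_proj:
  fixes S :: "(complex ^ 'n) set"
  assumes "vec.subspace S"
  shows "orth_proj S ** orth_proj S = orth_proj S \<and> hermitian (orth_proj S) \<and>
    range ((*v) (orth_proj S)) = S"
  unfolding orth_proj_def
proof (rule theI', rule ex_ex1I[OF orth_proj_exists[OF assms]])
  fix P Q :: "complex ^ 'n ^ 'n"
  assume P: "P ** P = P \<and> hermitian P \<and> range ((*v) P) = S"
    and Q: "Q ** Q = Q \<and> hermitian Q \<and> range ((*v) Q) = S"
  have "P *v x = Q *v x" for x
  proof (rule orth_proj_unique)
    show "Q *v x \<in> S" using Q by blast
    show "(x - Q *v x) \<bullet> w = 0" if "w \<in> S" for w
    proof -
      have "w \<in> range ((*v) Q)" using Q that by simp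
      then obtain z where w: "w = Q *v z" ..
      have "(Q *v x) \<bullet> w = x \<bullet> ((Q ** Q) *v z)"
        unfolding w matrix_vector_mul_assoc[symmetric] using Q hermitian_inner by blast
      then show ?thesis using Q by (simp add: inner_diff_left w)
    qed
    show "P ** P = P" "hermitian P" "range ((*v) P) = S" using P by simp_all
  qed
  then show "P = Q" by (simp add: matrix_eq)
qed

lemma orth_proj_fixes:
  assumes "vec.subspace S" "x \<in> S" shows "orth_proj S *v x = x"
  by (rule orth_proj_unique[of _ S]) (simp_all add: orth_proj[OF assms(1)] assms(2))

lemma orth_proj_annihilates:
  assumes "vec.subspace S" "\<And>w. w \<in> S \<Longrightarrow> x \<bullet> w = 0" shows "orth_proj S *v x = 0"
  by (rule orth_proj_unique[of _ S])
     (simp_all add: orth_proj[OF assms(1)] assms(2) vec.subspace_0[OF assms(1)])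

section \<open>Eigenspaces and functions of Hermitian matrices\<close>

lemma subspace_eigenspace: "vec.subspace (eigenspace A l)" for A :: "complex ^ 'n ^ 'n"
  unfolding vec.subspace_def eigenspace_def
  by (auto simp: matrix_vector_right_distrib scaleR_add_right vector_scalar_commute) (simp add: vec_eq_iff)

lemma eigenspaces_orthogonal:
  assumes "hermitian A" "A *v x = k *\<^sub>R x" "A *v y = l *\<^sub>R y" "k \<noteq> l"
  shows "x \<bullet> y = 0"
  using hermitian_inner[OF assms(1), of x y] assms(2-4) by simp

text \<open>One chosen eigenvector per eigenvalue gives a pairwise orthogonal family of nonzero
  vectors, which is finite in finite dimension.\<close>

lemma finite_eigenvalues:
  fixes A :: "complex ^ 'n ^ 'n"
  assumes "hermitian A" shows "finite {l. eigenspace A l \<noteq> {0}}"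
proof -
  have "\<exists>v. v \<noteq> 0 \<and> A *v v = l *\<^sub>R v" if "eigenspace A l \<noteq> {0}" for l
    using that vec.subspace_0[OF subspace_eigenspace[of A l]] by (auto simp: eigenspace_def)
  then obtain v where v: "\<And>l. eigenspace A l \<noteq> {0} \<Longrightarrow> v l \<noteq> 0 \<and> A *v v l = l *\<^sub>R v l"
    by metis
  have orth: "v k \<bullet> v l = 0"
    if "eigenspace A k \<noteq> {0}" "eigenspace A l \<noteq> {0}" "k \<noteq> l" for k l
    using eigenspaces_orthogonal[OF assms] v that by blast
  have "finite (v ` {l. eigenspace A l \<noteq> {0}})"
    by (rule pairwise_orthogonal_imp_finite) (auto simp: pairwise_def orthogonal_def intro: orth)
  moreover have "inj_on v {l. eigenspace A l \<noteq> {0}}"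
    using orth v by (fastforce intro: inj_onI)
  ultimately show ?thesis using finite_image_iff by blast
qed

lemma hermitian_herm_fun: "hermitian (herm_fun f A)"
  unfolding herm_fun_def
  by (intro hermitian_sum hermitian_scaleR) (use orth_proj subspace_eigenspace in blast)

text \<open>Projections onto the other eigenspaces annihilate v, leaving only the summand for l.
  Apart from hermiticity, this is the only property of \<open>herm_fun\<close> that the later
  arguments use.\<close>

lemma herm_fun_eigenvector:
  fixes A :: "complex ^ 'n ^ 'n"
  assumes A: "hermitian A" and v: "A *v v = l *\<^sub>R v"
  shows "herm_fun f A *v v = f l *\<^sub>R v"
proof (cases "v = 0")
  case False
  have "herm_fun f A *v v =
      (\<Sum>k | eigenspace A k \<noteq> {0}. f k *\<^sub>R (orth_proj (eigenspace A k) *v v))"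
    by (simp add: herm_fun_def sum_matrix_vector scaleR_matrix_vector)
  also have "\<dots> = (\<Sum>k | eigenspace A k \<noteq> {0}. if k = l then f l *\<^sub>R v else 0)"
  proof (intro sum.cong refl)
    fix k
    show "f k *\<^sub>R (orth_proj (eigenspace A k) *v v) = (if k = l then f l *\<^sub>R v else 0)"
    proof (cases "k = l")
      case True
      then show ?thesis
        using v orth_proj_fixes[OF subspace_eigenspace, of v A l] by (simp add: eigenspace_def)
    next
      case False
      then show ?thesis
        using v eigenspaces_orthogonal[OF A v]
        using orth_proj_annihilates[OF subspace_eigenspace, of A k v] by (auto simp: eigenspace_def)
    qed
  qed
  also have "\<dots> = f l *\<^sub>R v"
    using v False finite_eigenvalues[OF A] by (auto simp: sum.delta eigenspace_def)
  finally show ?thesis .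
qed simp

lemma hermitian_eigenbasis:
  fixes A :: "complex ^ 'n ^ 'n"
  assumes "hermitian A" "subspace S" "\<And>x. x \<in> S \<Longrightarrow> A *v x \<in> S"
  obtains B where "B \<subseteq> S" "orthonormal B" "span B = S"
    "\<And>b. b \<in> B \<Longrightarrow> A *v b = (b \<bullet> (A *v b)) *\<^sub>R b"
proof -
  obtain B where B: "B \<subseteq> S" "orthonormal B" "span B = S" "\<forall>b\<in>B. \<exists>l. A *v b = l *\<^sub>R b"
    using symmetric_eigenbasis[of "(*v) A" S] assms by (auto simp: hermitian_iff_symmetric)
  moreover have "A *v b = (b \<bullet> (A *v b)) *\<^sub>R b" if "b \<in> B" for b
    using B(4) orthonormal_inner[OF B(2) that that] that by auto
  ultimately show ?thesis using that by blast
qed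

lemma psd_eigensystem:
  fixes A :: "complex ^ 'n ^ 'n"
  assumes "A \<in> psd_mats"
  obtains B e where "nonneg_eigensystem ((*v) A) B e"
proof -
  obtain B where "orthonormal B" "span B = UNIV"
    "\<And>b. b \<in> B \<Longrightarrow> A *v b = (b \<bullet> (A *v b)) *\<^sub>R b"
    using hermitian_eigenbasis[of A UNIV] assms by (auto simp: psd_mats_def)
  then have "nonneg_eigensystem ((*v) A) B (\<lambda>b. b \<bullet> (A *v b))"
    using assms by (auto simp: nonneg_eigensystem_def psd_mats_def)
  then show ?thesis using that by blast
qed

text \<open>No case distinction is needed, since \<^term>\<open>ln 0 = (0 :: real)\<close> agrees with the
  convention in \<^const>\<open>mat_log\<close>.\<close>

lemma mat_log_eigenvector:
  assumes "hermitian A" "A *v v = l *\<^sub>R v"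
  shows "mat_log A *v v = ln l *\<^sub>R v"
  unfolding mat_log_def herm_fun_eigenvector[OF assms] by simp

lemma mat_exp_eigenvector:
  assumes "hermitian A" "A *v v = l *\<^sub>R v"
  shows "mat_exp A *v v = exp l *\<^sub>R v"
  unfolding mat_exp_def by (rule herm_fun_eigenvector[OF assms])

text \<open>Each complex coordinate contributes the two real basis directions 1 and i, and both give
  the real part of the diagonal entry; hence the factor 2.\<close>

lemma hs_inner_trace: "hs_inner (\<lambda>z. z) ((*v) M) = 2 * Re (trace M)" for M :: "complex ^ 'n ^ 'n"
proof -
  have Basis: "(Basis :: (complex ^ 'n) set) = (\<lambda>(i, u). axis i u) ` (UNIV \<times> Basis)"
    unfolding Basis_vec_def by (rule set_eqI) (simp add: image_iff Bex_def, blast)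
  have inj: "inj_on (\<lambda>(i, u). axis i u) (UNIV \<times> (Basis :: complex set))"
    by (intro inj_onI) (clarsimp simp: axis_eq_axis, metis nonzero_Basis)
  have entry: "(M *v axis i u) $ i = M $ i $ i * u" for i u
    by (simp add: matrix_vector_mult_def axis_def if_distrib sum.delta' cong: if_cong)
  have "hs_inner (\<lambda>z. z) ((*v) M) = (\<Sum>(i, u)\<in>UNIV \<times> Basis. axis i u \<bullet> (M *v axis i u))"
    unfolding hs_inner_def Basis sum.reindex[OF inj] by (simp add: case_prod_unfold)
  also have "\<dots> = (\<Sum>i\<in>UNIV. \<Sum>u\<in>Basis. u \<bullet> (M $ i $ i * u))"
    by (simp add: inner_axis' entry flip: sum.cartesian_product)
  also have "\<dots> = (\<Sum>i\<in>UNIV. 2 * Re (M $ i $ i))"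
    by (simp add: Basis_complex_def inner_complex_def)
  also have "\<dots> = 2 * Re (trace M)"
    by (simp add: trace_def sum_distrib_left)
  finally show ?thesis .
qed

section \<open>The variational principle and concavity\<close>

lemma eigensystem_symmetric:
  assumes "nonneg_eigensystem T B e"
  shows "T z \<bullet> w = z \<bullet> T w"
proof -
  note D = nonneg_eigensystemD[OF assms]
  have "T z \<bullet> w = (\<Sum>b\<in>B. (T z \<bullet> b) * (w \<bullet> b))" by (simp add: parseval[OF D(2,3)])
  also have "\<dots> = (\<Sum>b\<in>B. (z \<bullet> b) * (T w \<bullet> b))"
    by (intro sum.cong refl) (simp add: eigensystem_inner[OF assms])
  also have "\<dots> = z \<bullet> T w" by (simp add: parseval[OF D(2,3)])
  finally show ?thesis .
qed

lemma orthonormal_eq_0: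
  assumes "orthonormal B" "span B = (UNIV :: 'a::euclidean_space set)" "\<And>b. b \<in> B \<Longrightarrow> z \<bullet> b = 0"
  shows "z = 0"
proof -
  have "z \<bullet> z = (\<Sum>b\<in>B. (z \<bullet> b) * (z \<bullet> b))" using parseval[OF assms(1,2)] by simp
  also have "\<dots> = 0" by (rule sum.neutral) (simp add: assms(3))
  finally show ?thesis by simp
qed

lemma nonneg_eigensystem_null:
  assumes T: "nonneg_eigensystem T B e" and "z \<bullet> T z = 0"
  shows "T z = 0"
proof -
  note D = nonneg_eigensystemD[OF T]
  have nn: "0 \<le> e b * (z \<bullet> b)\<^sup>2" if "b \<in> B" for b
    using D(6)[OF that] by simp
  have "z \<bullet> T z = (\<Sum>b\<in>B. (z \<bullet> b) * (T z \<bullet> b))" by (simp add: parseval[OF D(2,3)])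
  also have "\<dots> = (\<Sum>b\<in>B. e b * (z \<bullet> b)\<^sup>2)"
    by (intro sum.cong refl) (simp add: eigensystem_inner[OF T] power2_eq_square)
  finally have "(\<Sum>b\<in>B. e b * (z \<bullet> b)\<^sup>2) = 0" using assms(2) by simp
  then have z: "e b * (z \<bullet> b)\<^sup>2 = 0" if "b \<in> B" for b
    using sum_nonneg_eq_0_iff[OF D(4) nn] that by simp
  have "T z \<bullet> b = 0" if "b \<in> B" for b
    using z[OF that] by (simp add: eigensystem_inner[OF T that])
  then show ?thesis by (rule orthonormal_eq_0[OF D(2,3)])
qed

lemma psd_null:
  assumes "A \<in> psd_mats" "z \<bullet> (A *v z) = 0" shows "A *v z = 0"
proof -
  obtain B e where "nonneg_eigensystem ((*v) A) B e" using psd_eigensystem[OF assms(1)] .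
  then show ?thesis using assms(2) by (rule nonneg_eigensystem_null)
qed

text \<open>Cyclicity of the trace, Tr(U* V P) = Tr(P U* V). In an eigenbasis of P, each P b is a
  real multiple of b, and the scalar moves across the inner product.\<close>

lemma hs_inner_symmetric_swap:
  assumes P: "hermitian P" and "linear U" "linear V"
  shows "hs_inner U (\<lambda>z. V (P *v z)) = hs_inner (\<lambda>z. U (P *v z)) V"
proof -
  obtain B where B: "orthonormal B" "span B = UNIV"
    "\<And>b. b \<in> B \<Longrightarrow> P *v b = (b \<bullet> (P *v b)) *\<^sub>R b"
    by (rule hermitian_eigenbasis[OF P subspace_UNIV]) simp_all
  have lin: "linear (\<lambda>z. U (P *v z))" "linear (\<lambda>z. V (P *v z))"
    using linear_compose[OF linear_matrix_vector assms(2)] linear_compose[OF linear_matrix_vector assms(3)]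
    by (simp_all add: o_def)
  have "U b \<bullet> V (P *v b) = U (P *v b) \<bullet> V b" if b: "b \<in> B" for b
  proof -
    obtain l where l: "P *v b = l *\<^sub>R b" using B(3)[OF b] by blast
    show ?thesis unfolding l by (simp add: linear_scale[OF assms(2)] linear_scale[OF assms(3)])
  qed
  then show ?thesis
    by (simp add: hs_inner_orthonormal[OF assms(2) lin(2) B(1,2)]
        hs_inner_orthonormal[OF lin(1) assms(3) B(1,2)])
qed

lemma subspace_range_matrix: "vec.subspace (range ((*v) A))" for A :: "complex ^ 'n ^ 'n"
  unfolding vec.subspace_def
proof (intro conjI ballI allI)
  show "0 \<in> range ((*v) A)" by (rule range_eqI[of _ _ 0]) simp
  show "x + y \<in> range ((*v) A)" if xy: "x \<in> range ((*v) A)" "y \<in> range ((*v) A)" for x y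
  proof -
    obtain a b where "x = A *v a" "y = A *v b" using xy by blast
    then have "x + y = A *v (a + b)" by (simp add: matrix_vector_right_distrib)
    then show ?thesis by simp
  qed
  show "c *s x \<in> range ((*v) A)" if x: "x \<in> range ((*v) A)" for c x
  proof -
    obtain a where "x = A *v a" using x by blast
    then have "c *s x = A *v (c *s a)" by (simp add: vector_scalar_commute)
    then show ?thesis by simp
  qed
qed

text \<open>The residual d of projecting w onto the range is orthogonal to that range, hence lies in
  the kernel. Then w is orthogonal to d, which forces d = 0.\<close>

lemma range_hermitianI:
  fixes A :: "complex ^ 'n ^ 'n"
  assumes A: "hermitian A" and w: "\<And>z. A *v z = 0 \<Longrightarrow> w \<bullet> z = 0"
  shows "w \<in> range ((*v) A)"
proof -
  define P where "P = orth_proj (range ((*v) A))"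
  have P: "P ** P = P" "hermitian P" "range ((*v) P) = range ((*v) A)"
    using orth_proj[OF subspace_range_matrix[of A]] by (simp_all add: P_def)
  have fix_range: "P *v (A *v y) = A *v y" for y
    unfolding P_def by (rule orth_proj_fixes[OF subspace_range_matrix]) simp
  define d where "d = w - P *v w"
  have "d \<bullet> (A *v y) = 0" for y
    using hermitian_inner[OF P(2), of w "A *v y"] by (simp add: d_def inner_diff_left fix_range)
  then have "A *v d = 0"
    using hermitian_inner[OF A, of d "A *v d"] by simp
  then have wd: "w \<bullet> d = 0" by (rule w)
  have "P *v d = 0"
    by (simp add: d_def matrix_vector_mult_diff_distrib matrix_vector_mul_assoc P(1))
  then have "(P *v w) \<bullet> d = 0" using hermitian_inner[OF P(2), of w d] by simp
  then have "d \<bullet> d = 0" using wd by (simp add: d_def inner_diff_left)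
  then have "w = P *v w" by (simp add: d_def)
  then show ?thesis using P(3) by blast
qed

section \<open>Spectral data of the log-Euclidean mean and the Gibbs identity\<close>

definition LE_proj :: "complex ^ 'n ^ 'n \<Rightarrow> complex ^ 'n ^ 'n \<Rightarrow> complex ^ 'n ^ 'n" where
  "LE_proj A B = orth_proj (range ((*v) A) \<inter> range ((*v) B))"

definition LE_exponent :: "real \<Rightarrow> complex ^ 'n ^ 'n \<Rightarrow> complex ^ 'n ^ 'n \<Rightarrow> complex ^ 'n ^ 'n" where
  "LE_exponent \<alpha> A B = (1 - \<alpha>) *\<^sub>R (LE_proj A B ** mat_log A ** LE_proj A B)
     + \<alpha> *\<^sub>R (LE_proj A B ** mat_log B ** LE_proj A B)"

lemma LE_eq: "LE \<alpha> A B = LE_proj A B ** mat_exp (LE_exponent \<alpha> A B)"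
  by (simp add: LE_def Let_def LE_proj_def LE_exponent_def proj_meet_def support_proj_def
      orth_proj[OF subspace_range_matrix])

lemma LE_proj:
  fixes A B :: "complex ^ 'n ^ 'n"
  shows "LE_proj A B ** LE_proj A B = LE_proj A B" "hermitian (LE_proj A B)"
    "range ((*v) (LE_proj A B)) = range ((*v) A) \<inter> range ((*v) B)"
  using orth_proj[OF vec.subspace_inter[OF subspace_range_matrix subspace_range_matrix], of A B]
  by (simp_all add: LE_proj_def)

lemma LE_proj_fixes: "w \<in> range ((*v) A) \<Longrightarrow> w \<in> range ((*v) B) \<Longrightarrow> LE_proj A B *v w = w"
  unfolding LE_proj_def
  by (rule orth_proj_fixes[OF vec.subspace_inter[OF subspace_range_matrix subspace_range_matrix]]) simp

lemma LE_exponent_apply: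
  "LE_exponent \<alpha> A B *v z =
    (1 - \<alpha>) *\<^sub>R (LE_proj A B *v (mat_log A *v (LE_proj A B *v z)))
    + \<alpha> *\<^sub>R (LE_proj A B *v (mat_log B *v (LE_proj A B *v z)))"
  by (simp add: LE_exponent_def matrix_vector_mult_add_rdistrib scaleR_matrix_vector
      flip: matrix_vector_mul_assoc)

lemma hermitian_LE_exponent: "hermitian (LE_exponent \<alpha> A B)"
  unfolding LE_exponent_def mat_log_def
  by (intro hermitian_add hermitian_scaleR hermitian_conjugate LE_proj(2) hermitian_herm_fun)

text \<open>The exponent preserves the range of \<open>LE_proj\<close> and vanishes on its kernel,
  so eigenbases of the two pieces can be joined. On the kernel the eigenvalue of \<open>LE\<close>
  is 0, and ln 0 = 0 matches the zero exponent: the logarithm formula holds on the whole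
  basis.\<close>

lemma LE_eigensystem:
  fixes A B :: "complex ^ 'n ^ 'n"
  obtains C y where "nonneg_eigensystem ((*v) (LE \<alpha> A B)) C y"
    "\<And>c. c \<in> C \<Longrightarrow> LE_exponent \<alpha> A B *v c = ln (y c) *\<^sub>R c"
    "\<And>c. c \<in> C \<Longrightarrow> y c = 0 \<and> LE_proj A B *v c = 0 \<or> y c \<noteq> 0 \<and> LE_proj A B *v c = c"
proof -
  define P where "P = LE_proj A B"
  define H where "H = LE_exponent \<alpha> A B"
  have P: "P ** P = P" "hermitian P" by (simp_all add: P_def LE_proj)
  have PP: "P *v (P *v z) = P *v z" for z by (simp add: matrix_vector_mul_assoc P)
  have H: "hermitian H" by (simp add: H_def hermitian_LE_exponent)
  have PH: "P *v (H *v z) = H *v z" for z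
    using PP by (simp add: H_def LE_exponent_apply P_def matrix_vector_right_distrib matrix_vector_scaleR)
  have HP: "H *v z = 0" if "P *v z = 0" for z
    using that by (simp add: H_def LE_exponent_apply P_def)
  have LE: "LE \<alpha> A B *v z = P *v (mat_exp H *v z)" for z
    by (simp add: LE_eq P_def H_def matrix_vector_mul_assoc)
  define R where "R = {z. P *v z = z}"
  define N where "N = {z. P *v z = 0}"
  have R: "subspace R" and N: "subspace N"
    by (auto simp: R_def N_def subspace_def matrix_vector_right_distrib matrix_vector_scaleR)
  obtain C1 where C1: "C1 \<subseteq> R" "orthonormal C1" "span C1 = R"
    "\<And>c. c \<in> C1 \<Longrightarrow> H *v c = (c \<bullet> (H *v c)) *\<^sub>R c"
    by (rule hermitian_eigenbasis[OF H R]) (simp_all add: R_def PH)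
  obtain C2 where C2: "C2 \<subseteq> N" "orthonormal C2" "span C2 = N"
    by (rule hermitian_eigenbasis[OF H N]) (simp_all add: N_def HP)
  have RN: "b \<bullet> c = 0" if "b \<in> R" "c \<in> N" for b c
    using hermitian_inner[OF P(2), of b c] that by (simp add: R_def N_def)
  define y where "y c = (if c \<in> C1 then exp (c \<bullet> (H *v c)) else 0)" for c
  have C1': "P *v c = c" "y c \<noteq> 0" "LE \<alpha> A B *v c = y c *\<^sub>R c" "H *v c = ln (y c) *\<^sub>R c"
    if "c \<in> C1" for c
  proof -
    show Pc: "P *v c = c" using C1(1) that by (auto simp: R_def)
    show "y c \<noteq> 0" using that by (simp add: y_def)
    show "H *v c = ln (y c) *\<^sub>R c" using C1(4)[OF that] that by (simp add: y_def)
    show "LE \<alpha> A B *v c = y c *\<^sub>R c"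
      unfolding LE mat_exp_eigenvector[OF H C1(4)[OF that]] matrix_vector_scaleR Pc
      using that by (simp add: y_def)
  qed
  have C2': "P *v c = 0" "y c = 0" "LE \<alpha> A B *v c = y c *\<^sub>R c" "H *v c = ln (y c) *\<^sub>R c"
    if "c \<in> C2" for c
  proof -
    show Pc: "P *v c = 0" using C2(1) that by (auto simp: N_def)
    have "c \<noteq> 0" using C2(2) that by (auto simp: orthonormal_def)
    then have "c \<notin> C1" using C1'(1) Pc by metis
    then show y: "y c = 0" by (simp add: y_def)
    have Hc: "H *v c = 0 *\<^sub>R c" using HP[OF Pc] by simp
    then show "H *v c = ln (y c) *\<^sub>R c" using y by simp
    \<comment> \<open>The exponential acts as the identity on the kernel; the projection in front of
      it turns the eigenvalue 1 into 0.\<close>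
    show "LE \<alpha> A B *v c = y c *\<^sub>R c"
      unfolding LE mat_exp_eigenvector[OF H Hc] using y Pc by simp
  qed
  have orth: "orthonormal (C1 \<union> C2)"
    unfolding orthonormal_def pairwise_def orthogonal_def
  proof (intro conjI ballI impI)
    fix b c assume bc: "b \<in> C1 \<union> C2" "c \<in> C1 \<union> C2" "b \<noteq> c"
    consider "b \<in> C1" "c \<in> C1" | "b \<in> C2" "c \<in> C2" | "b \<in> C1" "c \<in> C2" | "b \<in> C2" "c \<in> C1"
      using bc by blast
    then show "b \<bullet> c = 0"
    proof cases
      case 1 then show ?thesis using orthonormal_inner[OF C1(2)] bc(3) by simp
    next
      case 2 then show ?thesis using orthonormal_inner[OF C2(2)] bc(3) by simp
    next
      case 3 then show ?thesis using C1(1) C2(1) by (intro RN) auto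
    next
      case 4
      then have "c \<bullet> b = 0" using C1(1) C2(1) by (intro RN) auto
      then show ?thesis by (simp add: inner_commute)
    qed
  qed (use C1(2) C2(2) in \<open>auto simp: orthonormal_def\<close>)
  have span: "span (C1 \<union> C2) = UNIV"
  proof -
    have "z \<in> span (C1 \<union> C2)" for z
    proof -
      have "P *v z \<in> span C1" "z - P *v z \<in> span C2"
        unfolding C1(3) C2(3) by (simp_all add: R_def N_def PP matrix_vector_mult_diff_distrib)
      then have "P *v z \<in> span (C1 \<union> C2)" "z - P *v z \<in> span (C1 \<union> C2)"
        using span_mono[of C1 "C1 \<union> C2"] span_mono[of C2 "C1 \<union> C2"] by auto
      then have "P *v z + (z - P *v z) \<in> span (C1 \<union> C2)" by (rule span_add)
      then show ?thesis by simp
    qed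
    then show ?thesis by auto
  qed
  have "nonneg_eigensystem ((*v) (LE \<alpha> A B)) (C1 \<union> C2) y"
    unfolding nonneg_eigensystem_def
    using orth span C1'(3) C2'(3) by (auto simp: y_def)
  then show ?thesis
    using that[of "C1 \<union> C2" y] C1' C2' unfolding H_def P_def by blast
qed

text \<open>Both matrices are diagonal in the basis from \<open>LE_eigensystem\<close>, and their
  eigenvalues vanish at the same basis vectors.\<close>

lemma LE_null_iff: "LE \<alpha> A B *v z = 0 \<longleftrightarrow> LE_proj A B *v z = 0"
proof -
  obtain C y where C: "nonneg_eigensystem ((*v) (LE \<alpha> A B)) C y"
    "\<And>c. c \<in> C \<Longrightarrow> y c = 0 \<and> LE_proj A B *v c = 0 \<or> y c \<noteq> 0 \<and> LE_proj A B *v c = c"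
    using LE_eigensystem by metis
  note D = nonneg_eigensystemD[OF C(1)]
  have eq: "(LE \<alpha> A B *v z) \<bullet> c = 0 \<longleftrightarrow> (LE_proj A B *v z) \<bullet> c = 0" if "c \<in> C" for c
    using C(2)[OF that] hermitian_inner[OF LE_proj(2), of A B z c]
    by (auto simp: eigensystem_inner[OF C(1) that])
  show ?thesis
    using orthonormal_eq_0[OF D(2,3)] eq by (metis inner_zero_left)
qed

text \<open>The range of \<open>LE_proj\<close> lies in both ranges and is thus orthogonal to both
  kernels. This supplies the kernel inclusions for \<open>LE\<close>.\<close>

lemma LE_proj_null:
  assumes "hermitian A" "hermitian B" "A *v z = 0 \<or> B *v z = 0"
  shows "LE_proj A B *v z = 0"
proof -
  define w where "w = LE_proj A B *v z"
  have "w \<in> range ((*v) A) \<inter> range ((*v) B)"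
    unfolding w_def using LE_proj(3) by blast
  then obtain a b where ab: "w = A *v a" "w = B *v b" by blast
  have "z \<bullet> w = 0"
    using assms(3)
  proof
    assume "A *v z = 0"
    then show ?thesis using hermitian_inner[OF assms(1), of z a] by (simp add: ab(1))
  next
    assume "B *v z = 0"
    then show ?thesis using hermitian_inner[OF assms(2), of z b] by (simp add: ab(2))
  qed
  moreover have "w \<bullet> w = z \<bullet> w"
    using hermitian_inner[OF LE_proj(2), of A B z w]
    by (simp add: w_def matrix_vector_mul_assoc LE_proj(1))
  ultimately show ?thesis by (simp add: w_def)
qed

lemma psd_LE: "LE \<alpha> A B \<in> psd_mats"
proof -
  obtain C y where C: "nonneg_eigensystem ((*v) (LE \<alpha> A B)) C y"
    using LE_eigensystem by metis
  note D = nonneg_eigensystemD[OF C]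
  have "0 \<le> z \<bullet> (LE \<alpha> A B *v z)" for z
  proof -
    have "z \<bullet> (LE \<alpha> A B *v z) = (\<Sum>b\<in>C. (z \<bullet> b) * ((LE \<alpha> A B *v z) \<bullet> b))"
      by (simp add: parseval[OF D(2,3)])
    also have "\<dots> = (\<Sum>b\<in>C. y b * (z \<bullet> b)\<^sup>2)"
      by (intro sum.cong refl) (simp add: eigensystem_inner[OF C] power2_eq_square)
    finally show ?thesis using D(6) by (simp add: sum_nonneg)
  qed
  moreover have "hermitian (LE \<alpha> A B)"
    using eigensystem_symmetric[OF C] by (simp add: hermitian_iff_symmetric)
  ultimately show ?thesis by (simp add: psd_mats_def)
qed

text \<open>The last divergence is the nonnegative gap in Gibbs' variational principle; it vanishes
  at \<^term>\<open>X = LE \<alpha> A B\<close>.\<close>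

lemma Tr_LE_gibbs:
  fixes A B X :: "complex ^ 'n ^ 'n"
  assumes A: "nonneg_eigensystem ((*v) A) BA a" and B: "nonneg_eigensystem ((*v) B) BB b"
    and X: "nonneg_eigensystem ((*v) X) BX x"
    and Y: "nonneg_eigensystem ((*v) (LE \<alpha> A B)) BY y"
      "\<And>c. c \<in> BY \<Longrightarrow> LE_exponent \<alpha> A B *v c = ln (y c) *\<^sub>R c"
    and kerA: "\<And>z. A *v z = 0 \<Longrightarrow> X *v z = 0" and kerB: "\<And>z. B *v z = 0 \<Longrightarrow> X *v z = 0"
  shows "2 * Tr_LE \<alpha> (A, B) =
    (1 - \<alpha>) * (2 * Re (trace A) - divergence BX x BA a)
    + \<alpha> * (2 * Re (trace B) - divergence BX x BB b) + divergence BX x BY y"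
proof -
  have hA: "hermitian A" and hB: "hermitian B" and hX: "hermitian X"
    using eigensystem_symmetric[OF A] eigensystem_symmetric[OF B] eigensystem_symmetric[OF X]
    by (simp_all add: hermitian_iff_symmetric)
  define P where "P = LE_proj A B"
  have hP: "hermitian P" by (simp add: P_def LE_proj)
  \<comment> \<open>By the kernel inclusions, the range of X lies in the ranges of A and of
    B.\<close>
  have PX: "P *v (X *v w) = X *v w" for w
    unfolding P_def
  proof (rule LE_proj_fixes)
    show "X *v w \<in> range ((*v) A)"
      by (rule range_hermitianI[OF hA]) (simp add: hermitian_inner[OF hX] kerA)
    show "X *v w \<in> range ((*v) B)"
      by (rule range_hermitianI[OF hB]) (simp add: hermitian_inner[OF hX] kerB)
  qed
  have XP: "X *v (P *v w) = X *v w" for w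
  proof -
    have "(X *v (P *v w)) \<bullet> v = (X *v w) \<bullet> v" for v
      by (simp add: hermitian_inner[OF hX] hermitian_inner[OF hP] PX)
    then show ?thesis using vector_eq_rdot by blast
  qed
  \<comment> \<open>Since X absorbs P on either side, the compressions by P in the exponent are
    invisible to the pairing with X.\<close>
  have compress: "hs_inner ((*v) X) (\<lambda>z. P *v (L *v (P *v z))) = hs_inner ((*v) X) ((*v) L)" for L
  proof -
    have "hs_inner ((*v) X) (\<lambda>z. P *v (L *v (P *v z))) = hs_inner ((*v) X) (\<lambda>z. L *v (P *v z))"
      by (simp add: hs_inner_def PX flip: hermitian_inner[OF hP])
    also have "\<dots> = hs_inner (\<lambda>z. X *v (P *v z)) ((*v) L)"
      by (rule hs_inner_symmetric_swap[OF hP]) simp_all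
    finally show ?thesis by (simp add: XP)
  qed
  have log: "hs_inner ((*v) X) ((*v) (LE_exponent \<alpha> A B)) =
      (1 - \<alpha>) * hs_inner ((*v) X) ((*v) (mat_log A)) + \<alpha> * hs_inner ((*v) X) ((*v) (mat_log B))"
    unfolding LE_exponent_apply P_def[symmetric] hs_inner_add_right hs_inner_scale_right compress ..
  have divA: "divergence BX x BA a = (\<Sum>b\<in>BX. x b * ln (x b)) - hs_inner ((*v) X) ((*v) (mat_log A))
      - 2 * Re (trace X) + 2 * Re (trace A)"
    unfolding hs_inner_trace[symmetric]
    by (rule divergence_trace[OF X A]) (simp_all add: mat_log_eigenvector[OF hA] nonneg_eigensystemD(5)[OF A])
  have divB: "divergence BX x BB b = (\<Sum>b\<in>BX. x b * ln (x b)) - hs_inner ((*v) X) ((*v) (mat_log B))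
      - 2 * Re (trace X) + 2 * Re (trace B)"
    unfolding hs_inner_trace[symmetric]
    by (rule divergence_trace[OF X B]) (simp_all add: mat_log_eigenvector[OF hB] nonneg_eigensystemD(5)[OF B])
  have divY: "divergence BX x BY y = (\<Sum>b\<in>BX. x b * ln (x b))
      - hs_inner ((*v) X) ((*v) (LE_exponent \<alpha> A B))
      - 2 * Re (trace X) + 2 * Re (trace (LE \<alpha> A B))"
    unfolding hs_inner_trace[symmetric]
    by (rule divergence_trace[OF X Y(1)]) (simp_all add: Y(2))
  \<comment> \<open>The weights 1 - \<alpha> and \<alpha> sum to 1, so the entropy and trace of X,
    together with the logarithmic pairings, cancel against those in \<open>divY\<close>.\<close>
  show ?thesis
    unfolding divA divB divY log by (simp add: Tr_LE_def algebra_simps)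
qed

section \<open>Joint concavity of the trace\<close>

lemma psd_mats_combination:
  assumes "A \<in> psd_mats" "B \<in> psd_mats" "0 \<le> u" "0 \<le> v"
  shows "u *\<^sub>R A + v *\<^sub>R B \<in> psd_mats"
  using assms by (auto simp: psd_mats_def matrix_vector_mult_add_rdistrib scaleR_matrix_vector
      inner_add_right intro: hermitian_add hermitian_scaleR)

lemma convex_psd_mats: "convex psd_mats"
  by (rule convexI) (rule psd_mats_combination)

lemma psd_combination_null:
  assumes "A1 \<in> psd_mats" "A2 \<in> psd_mats" "0 < u" "0 < v" "(u *\<^sub>R A1 + v *\<^sub>R A2) *v z = 0"
  shows "A1 *v z = 0" "A2 *v z = 0"
proof -
  have nn: "0 \<le> z \<bullet> (A1 *v z)" "0 \<le> z \<bullet> (A2 *v z)" using assms(1,2) by (auto simp: psd_mats_def)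
  have "z \<bullet> ((u *\<^sub>R A1 + v *\<^sub>R A2) *v z) = 0" using assms(5) by simp
  then have "u * (z \<bullet> (A1 *v z)) + v * (z \<bullet> (A2 *v z)) = 0"
    by (simp add: matrix_vector_mult_add_rdistrib scaleR_matrix_vector inner_add_right)
  then have "z \<bullet> (A1 *v z) = 0" "z \<bullet> (A2 *v z) = 0"
    using nn assms(3,4) by (auto simp: add_nonneg_eq_0_iff)
  then show "A1 *v z = 0" "A2 *v z = 0" using psd_null assms(1,2) by blast+
qed

lemma Tr_LE_concave_combination:
  fixes A1 A2 B1 B2 :: "complex ^ 'n ^ 'n"
  assumes \<alpha>: "0 < \<alpha>" "\<alpha> < 1" and uv: "0 < u" "0 < v"
    and psd: "A1 \<in> psd_mats" "B1 \<in> psd_mats" "A2 \<in> psd_mats" "B2 \<in> psd_mats"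
  shows "u * Tr_LE \<alpha> (A1, B1) + v * Tr_LE \<alpha> (A2, B2)
    \<le> Tr_LE \<alpha> (u *\<^sub>R A1 + v *\<^sub>R A2, u *\<^sub>R B1 + v *\<^sub>R B2)"
proof -
  define A where "A = u *\<^sub>R A1 + v *\<^sub>R A2"
  define B where "B = u *\<^sub>R B1 + v *\<^sub>R B2"
  define X where "X = u *\<^sub>R LE \<alpha> A1 B1 + v *\<^sub>R LE \<alpha> A2 B2"
  have apply_comb: "(*v) (u *\<^sub>R M + v *\<^sub>R N) = (\<lambda>z. u *\<^sub>R (M *v z) + v *\<^sub>R (N *v z))"
    for M N :: "complex ^ 'n ^ 'n"
    by (rule ext) (simp add: matrix_vector_mult_add_rdistrib scaleR_matrix_vector)
  have psd_comb: "u *\<^sub>R M + v *\<^sub>R N \<in> psd_mats" if "M \<in> psd_mats" "N \<in> psd_mats"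
    for M N :: "complex ^ 'n ^ 'n"
    using psd_mats_combination[OF that] uv by simp
  have psd': "A \<in> psd_mats" "B \<in> psd_mats" "X \<in> psd_mats"
    unfolding A_def B_def X_def by (intro psd_comb psd psd_LE)+
  have herm: "hermitian A1" "hermitian A2" "hermitian B1" "hermitian B2" "hermitian A" "hermitian B"
    using psd psd' by (auto simp: psd_mats_def)
  obtain CA1 a1 where A1: "nonneg_eigensystem ((*v) A1) CA1 a1" using psd_eigensystem[OF psd(1)] .
  obtain CB1 b1 where B1: "nonneg_eigensystem ((*v) B1) CB1 b1" using psd_eigensystem[OF psd(2)] .
  obtain CA2 a2 where A2: "nonneg_eigensystem ((*v) A2) CA2 a2" using psd_eigensystem[OF psd(3)] .
  obtain CB2 b2 where B2: "nonneg_eigensystem ((*v) B2) CB2 b2" using psd_eigensystem[OF psd(4)] .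
  obtain CA a where A: "nonneg_eigensystem ((*v) A) CA a" using psd_eigensystem[OF psd'(1)] .
  obtain CB b where B: "nonneg_eigensystem ((*v) B) CB b" using psd_eigensystem[OF psd'(2)] .
  obtain CX x where X: "nonneg_eigensystem ((*v) X) CX x" using psd_eigensystem[OF psd'(3)] .
  obtain C1 y1 where Y1: "nonneg_eigensystem ((*v) (LE \<alpha> A1 B1)) C1 y1"
    "\<And>c. c \<in> C1 \<Longrightarrow> LE_exponent \<alpha> A1 B1 *v c = ln (y1 c) *\<^sub>R c"
    using LE_eigensystem by metis
  obtain C2 y2 where Y2: "nonneg_eigensystem ((*v) (LE \<alpha> A2 B2)) C2 y2"
    "\<And>c. c \<in> C2 \<Longrightarrow> LE_exponent \<alpha> A2 B2 *v c = ln (y2 c) *\<^sub>R c"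
    using LE_eigensystem by metis
  obtain C y where Y: "nonneg_eigensystem ((*v) (LE \<alpha> A B)) C y"
    "\<And>c. c \<in> C \<Longrightarrow> LE_exponent \<alpha> A B *v c = ln (y c) *\<^sub>R c"
    using LE_eigensystem by metis
  have ker1: "LE \<alpha> A1 B1 *v z = 0" if "A1 *v z = 0 \<or> B1 *v z = 0" for z
    unfolding LE_null_iff by (rule LE_proj_null[OF herm(1,3) that])
  have ker2: "LE \<alpha> A2 B2 *v z = 0" if "A2 *v z = 0 \<or> B2 *v z = 0" for z
    unfolding LE_null_iff by (rule LE_proj_null[OF herm(2,4) that])
  have kerX: "X *v z = 0" if "LE \<alpha> A1 B1 *v z = 0" "LE \<alpha> A2 B2 *v z = 0" for z
    using that by (simp add: X_def apply_comb)
  have kerA: "X *v z = 0" if "A *v z = 0" for z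
    using psd_combination_null[OF psd(1,3) uv that[unfolded A_def]] 
    by (intro kerX ker1 ker2 disjI1)
  have kerB: "X *v z = 0" if "B *v z = 0" for z
    using psd_combination_null[OF psd(2,4) uv that[unfolded B_def]] 
    by (intro kerX ker1 ker2 disjI2)
  \<comment> \<open>This inclusion is what makes the Gibbs gap at (A, B) nonnegative. It holds
    because \<open>LE_proj A B\<close> fixes the range of X and can be moved onto z by
    symmetry.\<close>
  have kerY: "X *v z = 0" if z: "LE \<alpha> A B *v z = 0" for z
  proof -
    have hX: "hermitian X" using psd'(3) by (simp add: psd_mats_def)
    have range: "X *v w \<in> range ((*v) A)" "X *v w \<in> range ((*v) B)" for w
      by (intro range_hermitianI herm; simp add: hermitian_inner[OF hX] kerA kerB)+
    have "(X *v z) \<bullet> (X *v z) = z \<bullet> (LE_proj A B *v (X *v (X *v z)))"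
      by (simp add: hermitian_inner[OF hX] LE_proj_fixes[OF range])
    also have "\<dots> = (LE_proj A B *v z) \<bullet> (X *v (X *v z))"
      by (simp add: hermitian_inner[OF LE_proj(2)])
    also have "\<dots> = 0" using z by (simp add: LE_null_iff)
    finally show ?thesis by simp
  qed
  have DA: "divergence CX x CA a \<le> u * divergence C1 y1 CA1 a1 + v * divergence C2 y2 CA2 a2"
    by (rule divergence_jointly_convex[OF Y1(1) Y2(1) A1 A2 X[unfolded X_def apply_comb] A[unfolded A_def apply_comb]])
       (fact ker1[OF disjI1] ker2[OF disjI1] kerA[unfolded A_def X_def apply_comb]
          uv[THEN less_imp_le])+
  have DB: "divergence CX x CB b \<le> u * divergence C1 y1 CB1 b1 + v * divergence C2 y2 CB2 b2"
    by (rule divergence_jointly_convex[OF Y1(1) Y2(1) B1 B2 X[unfolded X_def apply_comb] B[unfolded B_def apply_comb]])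
       (fact ker1[OF disjI2] ker2[OF disjI2] kerB[unfolded B_def X_def apply_comb]
          uv[THEN less_imp_le])+
  \<comment> \<open>At its own maximizer the Gibbs gap vanishes, so the variational bound is an
    equality at each endpoint.\<close>
  have G1: "2 * Tr_LE \<alpha> (A1, B1) = (1 - \<alpha>) * (2 * Re (trace A1) - divergence C1 y1 CA1 a1)
      + \<alpha> * (2 * Re (trace B1) - divergence C1 y1 CB1 b1)"
    using Tr_LE_gibbs[OF A1 B1 Y1(1) Y1 ker1[OF disjI1] ker1[OF disjI2]]
      divergence_self[OF Y1(1)] by simp
  have G2: "2 * Tr_LE \<alpha> (A2, B2) = (1 - \<alpha>) * (2 * Re (trace A2) - divergence C2 y2 CA2 a2)
      + \<alpha> * (2 * Re (trace B2) - divergence C2 y2 CB2 b2)"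
    using Tr_LE_gibbs[OF A2 B2 Y2(1) Y2 ker2[OF disjI1] ker2[OF disjI2]]
      divergence_self[OF Y2(1)] by simp
  have tr: "Re (trace A) = u * Re (trace A1) + v * Re (trace A2)"
    "Re (trace B) = u * Re (trace B1) + v * Re (trace B2)"
    by (simp_all add: A_def B_def trace_def sum.distrib sum_distrib_left)
  have "u * (2 * Tr_LE \<alpha> (A1, B1)) + v * (2 * Tr_LE \<alpha> (A2, B2)) =
      (1 - \<alpha>) * (2 * Re (trace A) - (u * divergence C1 y1 CA1 a1 + v * divergence C2 y2 CA2 a2))
      + \<alpha> * (2 * Re (trace B) - (u * divergence C1 y1 CB1 b1 + v * divergence C2 y2 CB2 b2))"
    unfolding G1 G2 tr by (simp add: algebra_simps)
  also have "\<dots> \<le> (1 - \<alpha>) * (2 * Re (trace A) - divergence CX x CA a)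
      + \<alpha> * (2 * Re (trace B) - divergence CX x CB b)"
    using DA DB \<alpha> by (intro add_mono mult_left_mono) auto
  \<comment> \<open>X is only a trial point for (A, B), and the nonnegative gap is dropped.\<close>
  also have "\<dots> \<le> 2 * Tr_LE \<alpha> (A, B)"
    using Tr_LE_gibbs[OF A B X Y kerA kerB] divergence_nonneg[OF X Y(1) kerY] by simp
  finally show ?thesis by (simp add: A_def B_def)
qed

lemma Tr_LE_concave:
  assumes "0 < \<alpha>" "\<alpha> < 1"
  shows "concave_on (psd_mats \<times> psd_mats :: ((complex ^ 'n ^ 'n) \<times> (complex ^ 'n ^ 'n)) set) (Tr_LE \<alpha>)"
  unfolding concave_on_iff
proof (intro conjI ballI allI impI)
  show "convex (psd_mats \<times> psd_mats :: ((complex ^ 'n ^ 'n) \<times> (complex ^ 'n ^ 'n)) set)"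
    by (intro convex_Times convex_psd_mats)
  fix p q :: "(complex ^ 'n ^ 'n) \<times> (complex ^ 'n ^ 'n)" and u v :: real
  assume pq: "p \<in> psd_mats \<times> psd_mats" "q \<in> psd_mats \<times> psd_mats" and uv: "0 \<le> u" "0 \<le> v" "u + v = 1"
  \<comment> \<open>Zero weights are separated because the kernel of a combination is contained in
    both kernels only for positive weights.\<close>
  consider "u = 0" "v = 1" | "v = 0" "u = 1" | "0 < u" "0 < v" using uv by linarith
  then show "u * Tr_LE \<alpha> p + v * Tr_LE \<alpha> q \<le> Tr_LE \<alpha> (u *\<^sub>R p + v *\<^sub>R q)"
  proof cases
    case 3
    then show ?thesis
      using Tr_LE_concave_combination[OF assms, of u v "fst p" "snd p" "fst q" "snd q"] pq
      by (auto simp: scaleR_prod_def plus_prod_def mem_Times_iff)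
  qed simp_all
qed

section \<open>The two-dimensional counterexample\<close>

text \<open>Eigenvectors span the space, so a guessed value of \<open>herm_fun\<close> is verified
  on them alone, without computing eigenspaces or projections.\<close>

lemma herm_fun_eqI:
  fixes A G :: "complex ^ 'n ^ 'n"
  assumes A: "hermitian A" and G: "\<And>v l. A *v v = l *\<^sub>R v \<Longrightarrow> G *v v = f l *\<^sub>R v"
  shows "herm_fun f A = G"
proof -
  obtain B where B: "span B = UNIV" "\<And>b. b \<in> B \<Longrightarrow> A *v b = (b \<bullet> (A *v b)) *\<^sub>R b"
    by (rule hermitian_eigenbasis[OF A subspace_UNIV]) simp_all
  have "herm_fun f A *v x = G *v x" for x
  proof (rule linear_eq_on_span[OF linear_matrix_vector linear_matrix_vector, of B])
    show "herm_fun f A *v b = G *v b" if "b \<in> B" for b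
      using herm_fun_eigenvector[OF A B(2)[OF that], of f] G[OF B(2)[OF that]] by simp
  qed (simp add: B(1))
  then show ?thesis by (simp add: matrix_eq)
qed

definition sym2 :: "real \<Rightarrow> real \<Rightarrow> real \<Rightarrow> complex ^ 2 ^ 2" where
  "sym2 p q r = vector [vector [of_real p, of_real q], vector [of_real q, of_real r]]"

lemma hermitian_sym2: "hermitian (sym2 p q r)"
  by (simp add: hermitian_def adjoint_mat_def sym2_def vec_eq_iff forall_2)

lemma sym2_apply: "(sym2 p q r *v x) $ 1 = p *\<^sub>R (x $ 1) + q *\<^sub>R (x $ 2)"
  "(sym2 p q r *v x) $ 2 = q *\<^sub>R (x $ 1) + r *\<^sub>R (x $ 2)"
  by (simp_all add: matrix_vector_mult_def sym2_def sum_2 scaleR_conv_of_real)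

lemma sym2_add: "sym2 p q r + sym2 p' q' r' = sym2 (p + p') (q + q') (r + r')"
  and sym2_scaleR: "c *\<^sub>R sym2 p q r = sym2 (c * p) (c * q) (c * r)"
  by (simp_all add: sym2_def vec_eq_iff forall_2 scaleR_conv_of_real[where 'a = complex])

lemma trace_sym2: "trace (sym2 p q r) = of_real (p + r)"
  by (simp add: trace_def sum_2 sym2_def)

lemma sym2_pd:
  assumes "0 < p" "q\<^sup>2 < p * r"
  shows "sym2 p q r \<in> pd_mats"
proof -
  have "0 < x \<bullet> (sym2 p q r *v x)" if x: "x \<noteq> 0" for x
  proof -
    define y z where "y = x $ 1" and "z = x $ 2"
    define w where "w = p *\<^sub>R y + q *\<^sub>R z"
    \<comment> \<open>Multiplying by p completes the square without division.\<close>
    have "p * (x \<bullet> (sym2 p q r *v x)) = p * (y \<bullet> (p *\<^sub>R y + q *\<^sub>R z) + z \<bullet> (q *\<^sub>R y + r *\<^sub>R z))"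
      by (simp add: inner_vec_def sum_2 sym2_apply y_def z_def)
    also have "\<dots> = w \<bullet> w + (p * r - q\<^sup>2) * (z \<bullet> z)"
      by (simp add: w_def inner_add_left inner_add_right inner_commute[of z y] algebra_simps power2_eq_square)
    also have "\<dots> > 0"
    proof (cases "z = 0")
      case True
      then have "y \<noteq> 0" using x by (auto simp: y_def z_def vec_eq_iff forall_2)
      then have "w \<noteq> 0" using True assms(1) by (simp add: w_def)
      then show ?thesis using True by simp
    next
      case False
      then have "0 < (p * r - q\<^sup>2) * (z \<bullet> z)" using assms(2) by simp
      then show ?thesis using inner_ge_zero[of w] by linarith
    qed
    finally show ?thesis using assms(1) by (simp add: zero_less_mult_iff)
  qed
  then show ?thesis by (simp add: pd_mats_def hermitian_sym2)
qed

lemma mat_log_diag: "mat_log (sym2 p 0 r) = sym2 (ln p) 0 (ln r)"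
  unfolding mat_log_def
proof (rule herm_fun_eqI[OF hermitian_sym2])
  fix v l assume "sym2 p 0 r *v v = l *\<^sub>R v"
  then have "p *\<^sub>R (v $ 1) = l *\<^sub>R (v $ 1)" "r *\<^sub>R (v $ 2) = l *\<^sub>R (v $ 2)"
    by (simp_all add: vec_eq_iff forall_2 sym2_apply)
  then have "ln p *\<^sub>R (v $ 1) = ln l *\<^sub>R (v $ 1)" "ln r *\<^sub>R (v $ 2) = ln l *\<^sub>R (v $ 2)" by auto
  then show "sym2 (ln p) 0 (ln r) *v v = (if l = 0 then 0 else ln l) *\<^sub>R v"
    by (auto simp: vec_eq_iff forall_2 sym2_apply)
qed

text \<open>The matrix is I + (a - 1) Q with Q the projection onto the span of (1, -1), so its
  logarithm is (ln a) Q. Sum and difference of the coordinates separate the eigenvalues 1 and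
  a.\<close>

lemma mat_log_rank_one_perturbation:
  assumes "a \<noteq> 1"
  shows "mat_log (sym2 ((1 + a) / 2) ((1 - a) / 2) ((1 + a) / 2)) = sym2 (ln a / 2) (- ln a / 2) (ln a / 2)"
  unfolding mat_log_def
proof (rule herm_fun_eqI[OF hermitian_sym2])
  fix v l assume "sym2 ((1 + a) / 2) ((1 - a) / 2) ((1 + a) / 2) *v v = l *\<^sub>R v"
  then have eq: "((1 + a) / 2) *\<^sub>R (v $ 1) + ((1 - a) / 2) *\<^sub>R (v $ 2) = l *\<^sub>R (v $ 1)"
    "((1 - a) / 2) *\<^sub>R (v $ 1) + ((1 + a) / 2) *\<^sub>R (v $ 2) = l *\<^sub>R (v $ 2)"
    by (simp_all add: vec_eq_iff forall_2 sym2_apply)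
  have "l *\<^sub>R (v $ 1) + l *\<^sub>R (v $ 2) = v $ 1 + v $ 2"
    unfolding eq[symmetric] by (simp add: scaleR_conv_of_real field_simps)
  then have plus: "(l - 1) *\<^sub>R (v $ 1 + v $ 2) = 0" by (simp add: algebra_simps)
  have "l *\<^sub>R (v $ 1) - l *\<^sub>R (v $ 2) = a *\<^sub>R (v $ 1 - v $ 2)"
    unfolding eq[symmetric] by (simp add: scaleR_conv_of_real field_simps)
  then have minus: "(l - a) *\<^sub>R (v $ 1 - v $ 2) = 0" by (simp add: algebra_simps)
  have "(ln a / 2) *\<^sub>R (v $ 1) - (ln a / 2) *\<^sub>R (v $ 2) = ln l *\<^sub>R (v $ 1) \<and>
    (ln a / 2) *\<^sub>R (v $ 2) - (ln a / 2) *\<^sub>R (v $ 1) = ln l *\<^sub>R (v $ 2)"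
  proof (cases "l = 1")
    case True
    then show ?thesis using minus assms by simp
  next
    case False
    then have v2: "v $ 2 = - (v $ 1)" using plus by (simp add: add_eq_0_iff)
    then have "l = a \<or> v $ 1 = 0" using minus by simp
    then show ?thesis by (auto simp: v2 scaleR_conv_of_real)
  qed
  then show "sym2 (ln a / 2) (- ln a / 2) (ln a / 2) *v v = (if l = 0 then 0 else ln l) *\<^sub>R v"
    by (simp add: vec_eq_iff forall_2 sym2_apply)
qed

text \<open>The matrix is m I + K with K^2 = \<mu>^2 I, so exp K = cosh \<mu> I + (sinh \<mu> /
  \<mu>) K. For \<mu> = 0 the junk value h = 0 is harmless, as K = 0.\<close>

lemma mat_exp_sym2:
  fixes m d k :: real
  defines "\<mu> \<equiv> sqrt (d\<^sup>2 + k\<^sup>2)"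
  defines "h \<equiv> sinh \<mu> / \<mu>"
  shows "mat_exp (sym2 (m + d) k (m - d)) =
    sym2 (exp m * (cosh \<mu> + h * d)) (exp m * (h * k)) (exp m * (cosh \<mu> - h * d))"
  unfolding mat_exp_def
proof (rule herm_fun_eqI[OF hermitian_sym2])
  fix v l assume ev: "sym2 (m + d) k (m - d) *v v = l *\<^sub>R v"
  define x y \<delta> where "x = v $ 1" and "y = v $ 2" and "\<delta> = l - m"
  have e1: "d *\<^sub>R x + k *\<^sub>R y = \<delta> *\<^sub>R x" and e2: "k *\<^sub>R x - d *\<^sub>R y = \<delta> *\<^sub>R y"
    using ev by (simp_all add: vec_eq_iff forall_2 sym2_apply x_def y_def \<delta>_def algebra_simps)
  have "sym2 (exp m * (cosh \<mu> + h * d)) (exp m * (h * k)) (exp m * (cosh \<mu> - h * d)) *v v = exp l *\<^sub>R v"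
  proof (cases "v = 0")
    case False
    have "\<delta>\<^sup>2 *\<^sub>R x = \<delta> *\<^sub>R (d *\<^sub>R x + k *\<^sub>R y)" by (simp add: e1 power2_eq_square)
    also have "\<dots> = d *\<^sub>R (\<delta> *\<^sub>R x) + k *\<^sub>R (\<delta> *\<^sub>R y)" by (simp add: algebra_simps)
    also have "\<dots> = (d\<^sup>2 + k\<^sup>2) *\<^sub>R x"
      unfolding e1[symmetric] e2[symmetric] by (simp add: algebra_simps power2_eq_square)
    finally have x: "\<delta>\<^sup>2 *\<^sub>R x = (d\<^sup>2 + k\<^sup>2) *\<^sub>R x" .
    have "\<delta>\<^sup>2 *\<^sub>R y = \<delta> *\<^sub>R (k *\<^sub>R x - d *\<^sub>R y)" by (simp add: e2 power2_eq_square)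
    also have "\<dots> = k *\<^sub>R (\<delta> *\<^sub>R x) - d *\<^sub>R (\<delta> *\<^sub>R y)" by (simp add: algebra_simps)
    also have "\<dots> = (d\<^sup>2 + k\<^sup>2) *\<^sub>R y"
      unfolding e1[symmetric] e2[symmetric] by (simp add: algebra_simps power2_eq_square)
    finally have y: "\<delta>\<^sup>2 *\<^sub>R y = (d\<^sup>2 + k\<^sup>2) *\<^sub>R y" .
    have "x \<noteq> 0 \<or> y \<noteq> 0" using False by (auto simp: x_def y_def vec_eq_iff forall_2)
    then have "\<delta>\<^sup>2 = d\<^sup>2 + k\<^sup>2" using x y by auto
    then have "\<mu> = \<bar>\<delta>\<bar>" unfolding \<mu>_def by (metis real_sqrt_abs)
    \<comment> \<open>Oddness of sinh and evenness of cosh absorb the sign of \<delta>; for \<delta>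
      = 0 both sides of the sinh equations are 0.\<close>
    then have h: "h * \<delta> = sinh \<delta>" "\<delta> * h = sinh \<delta>" "cosh \<mu> = cosh \<delta>"
      by (auto simp: h_def abs_if)
    have l: "exp l = exp m * (cosh \<delta> + sinh \<delta>)"
      by (simp add: \<delta>_def cosh_plus_sinh flip: exp_add)
    have "(exp m * (cosh \<mu> + h * d)) *\<^sub>R x + (exp m * (h * k)) *\<^sub>R y
        = (exp m * cosh \<delta>) *\<^sub>R x + (exp m * h) *\<^sub>R (d *\<^sub>R x + k *\<^sub>R y)"
      by (simp add: h(3) algebra_simps)
    also have "\<dots> = exp l *\<^sub>R x"
      by (simp add: e1 l h(2) algebra_simps flip: scaleR_add_left)
    finally have r1: "(exp m * (cosh \<mu> + h * d)) *\<^sub>R x + (exp m * (h * k)) *\<^sub>R y = exp l *\<^sub>R x" .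
    have "(exp m * (h * k)) *\<^sub>R x + (exp m * (cosh \<mu> - h * d)) *\<^sub>R y
        = (exp m * cosh \<delta>) *\<^sub>R y + (exp m * h) *\<^sub>R (k *\<^sub>R x - d *\<^sub>R y)"
      by (simp add: h(3) algebra_simps)
    also have "\<dots> = exp l *\<^sub>R y"
      by (simp add: e2 l h(2) algebra_simps flip: scaleR_add_left)
    finally show ?thesis
      using r1 by (simp add: vec_eq_iff forall_2 sym2_apply x_def y_def)
  qed simp
  then show "sym2 (exp m * (cosh \<mu> + h * d)) (exp m * (h * k)) (exp m * (cosh \<mu> - h * d)) *v v = exp l *\<^sub>R v" .
qed

lemma Re_trace_mat_exp_sym2:
  "Re (trace (mat_exp (sym2 (m + d) k (m - d)))) = 2 * exp m * cosh (sqrt (d\<^sup>2 + k\<^sup>2))"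
  unfolding mat_exp_sym2 trace_sym2 by (simp add: algebra_simps)

section \<open>Failure of convexity along a two-dimensional family\<close>

text \<open>The choice of a gives (1 - \<alpha>) ln a = -t, so the exponent is -t Q + \<alpha> log
  B; m is half its trace, and its off-diagonal entry is t/2.\<close>

lemma Tr_LE_sym2:
  assumes \<alpha>: "1 < \<alpha>" and t: "0 < t" and pr: "0 < p" "0 < r"
  defines "a \<equiv> exp (t / (\<alpha> - 1))"
  shows "Tr_LE \<alpha> (sym2 ((1 + a) / 2) ((1 - a) / 2) ((1 + a) / 2), sym2 p 0 r) =
    2 * exp (\<alpha> * (ln p + ln r) / 2 - t / 2) * cosh (sqrt ((\<alpha> * (ln p - ln r) / 2)\<^sup>2 + (t / 2)\<^sup>2))"
    and "sym2 ((1 + a) / 2) ((1 - a) / 2) ((1 + a) / 2) \<in> pd_mats"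
    and "sym2 p 0 r \<in> pd_mats"
proof -
  have a: "a > 1" using \<alpha> t by (simp add: a_def)
  show A: "sym2 ((1 + a) / 2) ((1 - a) / 2) ((1 + a) / 2) \<in> pd_mats"
    using a by (intro sym2_pd) (simp_all add: power2_eq_square field_simps)
  show B: "sym2 p 0 r \<in> pd_mats" using pr by (intro sym2_pd) simp_all
  define m d where "m = \<alpha> * (ln p + ln r) / 2 - t / 2" and "d = \<alpha> * (ln p - ln r) / 2"
  have "(1 - \<alpha>) * (ln a / 2) = - t / 2" using \<alpha> by (simp add: a_def field_simps)
  then have "(1 - \<alpha>) * (ln a / 2) + \<alpha> * ln p = m + d" "(1 - \<alpha>) * (ln a / 2) + \<alpha> * ln r = m - d"
    "(1 - \<alpha>) * (- ln a / 2) + \<alpha> * 0 = t / 2"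
    by (simp_all add: m_def d_def field_simps)
  then have "(1 - \<alpha>) *\<^sub>R sym2 (ln a / 2) (- ln a / 2) (ln a / 2) + \<alpha> *\<^sub>R sym2 (ln p) 0 (ln r)
      = sym2 (m + d) (t / 2) (m - d)"
    by (simp only: sym2_scaleR sym2_add)
  then have "LE \<alpha> (sym2 ((1 + a) / 2) ((1 - a) / 2) ((1 + a) / 2)) (sym2 p 0 r) =
      mat_exp (sym2 (m + d) (t / 2) (m - d))"
    using a by (simp only: LE_pd[OF A B] mat_log_diag mat_log_rank_one_perturbation[of a])
  then show "Tr_LE \<alpha> (sym2 ((1 + a) / 2) ((1 - a) / 2) ((1 + a) / 2), sym2 p 0 r) =
    2 * exp (\<alpha> * (ln p + ln r) / 2 - t / 2) * cosh (sqrt ((\<alpha> * (ln p - ln r) / 2)\<^sup>2 + (t / 2)\<^sup>2))"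
    by (simp add: Tr_LE_def Re_trace_mat_exp_sym2 m_def d_def)
qed

text \<open>The square root exceeds t/2 by O(1/t), so twice its cosh is asymptotic to
  exp(t/2).\<close>

lemma cosh_sqrt_limit:
  fixes d :: real
  shows "((\<lambda>t. 2 * exp (- t / 2) * cosh (sqrt (d\<^sup>2 + (t / 2)\<^sup>2))) \<longlongrightarrow> 1) at_top"
  by real_asymp

lemma Tr_LE_not_convex:
  assumes \<alpha>: "1 < \<alpha>"
  shows "\<not> convex_on (pd_mats \<times> pd_mats :: ((complex ^ 2 ^ 2) \<times> (complex ^ 2 ^ 2)) set) (Tr_LE \<alpha>)"
proof
  assume conv: "convex_on (pd_mats \<times> pd_mats :: ((complex ^ 2 ^ 2) \<times> (complex ^ 2 ^ 2)) set) (Tr_LE \<alpha>)"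
  \<comment> \<open>The value at either endpoint divided by its limit 2 powr \<alpha>; the entries 4
    and 1 give d = \<alpha> ln 2 up to sign.\<close>
  define g where "g t = 2 * exp (- t / 2) * cosh (sqrt ((\<alpha> * ln 2)\<^sup>2 + (t / 2)\<^sup>2))" for t
  have "(g \<longlongrightarrow> 1) at_top"
    unfolding g_def by (rule cosh_sqrt_limit)
  \<comment> \<open>The number (5/4) powr \<alpha> is the ratio of the limiting midpoint value (5/2)
    powr \<alpha> to the limiting endpoint value.\<close>
  moreover have "1 < exp (\<alpha> * ln (5 / 4 :: real))" using \<alpha> by simp
  ultimately have "\<forall>\<^sub>F t in at_top. g t < exp (\<alpha> * ln (5 / 4)) \<and> 0 < t"
    by (intro eventually_conj order_tendstoD eventually_gt_at_top)
  then obtain t where t: "g t < exp (\<alpha> * ln (5 / 4))" "0 < t"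
    unfolding eventually_at_top_linorder by blast
  define a where "a = exp (t / (\<alpha> - 1))"
  \<comment> \<open>The same A serves at both points, so convexity already fails in the second
    argument alone.\<close>
  define A where "A = sym2 ((1 + a) / 2) ((1 - a) / 2) ((1 + a) / 2)"
  note Tr = Tr_LE_sym2[OF \<alpha> t(2), folded a_def, folded A_def]
  have ln4: "ln 4 = 2 * ln (2 :: real)" using ln_realpow[of 2 2] by simp
  have ends: "Tr_LE \<alpha> (A, sym2 4 0 1) = exp (\<alpha> * ln 2) * g t" "Tr_LE \<alpha> (A, sym2 1 0 4) = exp (\<alpha> * ln 2) * g t"
    by (simp_all add: Tr(1) g_def ln4 flip: exp_add)
  \<comment> \<open>At a scalar B the parameter d is 0 and the square root collapses to t/2, so the
    midpoint value is exact and exceeds its limit.\<close>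
  have mid: "Tr_LE \<alpha> (A, sym2 (5 / 2) 0 (5 / 2)) = exp (\<alpha> * ln (5 / 2)) * (1 + exp (- t))"
  proof -
    have "Tr_LE \<alpha> (A, sym2 (5 / 2) 0 (5 / 2)) = 2 * exp (\<alpha> * ln (5 / 2) - t / 2) * cosh (t / 2)"
      using t(2) by (simp add: Tr(1) real_sqrt_divide power_divide)
    also have "\<dots> = exp (\<alpha> * ln (5 / 2)) * (1 + exp (- t))"
      by (simp add: cosh_def distrib_left flip: exp_add)
    finally show ?thesis .
  qed
  have "Tr_LE \<alpha> ((1 / 2) *\<^sub>R (A, sym2 4 0 1) + (1 / 2) *\<^sub>R (A, sym2 1 0 4))
      \<le> (1 / 2) * Tr_LE \<alpha> (A, sym2 4 0 1) + (1 / 2) * Tr_LE \<alpha> (A, sym2 1 0 4)"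
    by (rule conv[unfolded convex_on_def, THEN conjunct2, rule_format])
       (use Tr(2)[of 1 1] Tr(3)[of 4 1] Tr(3)[of 1 4] in simp_all)
  moreover have "(1 / 2) *\<^sub>R (A, sym2 4 0 1) + (1 / 2) *\<^sub>R (A, sym2 1 0 4) = (A, sym2 (5 / 2) 0 (5 / 2))"
    by (simp add: sym2_scaleR sym2_add flip: scaleR_add_left)
  ultimately have "exp (\<alpha> * ln (5 / 2)) * (1 + exp (- t)) \<le> exp (\<alpha> * ln 2) * g t"
    unfolding mid[symmetric] by (simp add: ends mult.commute)
  also have "\<dots> < exp (\<alpha> * ln 2) * exp (\<alpha> * ln (5 / 4))" using t(1) by simp
  also have "\<dots> = exp (\<alpha> * (ln 2 + ln (5 / 4)))" by (simp add: distrib_left exp_add)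
  also have "ln 2 + ln (5 / 4) = ln (5 / 2 :: real)" by (simp flip: ln_mult_pos)
  finally show False by (simp add: mult_le_cancel_left1)
qed

theorem theorem5p12:
  shows "(\<forall>\<alpha>::real. 0 < \<alpha> \<and> \<alpha> < 1 \<longrightarrow>
            concave_on (psd_mats \<times> psd_mats :: ((complex ^ 'n ^ 'n) \<times> (complex ^ 'n ^ 'n)) set) (Tr_LE \<alpha>)) \<and>
         (\<forall>\<alpha>::real. 1 < \<alpha> \<longrightarrow>
            \<not> convex_on (pd_mats \<times> pd_mats :: ((complex ^ 2 ^ 2) \<times> (complex ^ 2 ^ 2)) set) (Tr_LE \<alpha>))"
  using Tr_LE_concave Tr_LE_not_convex by blast

end
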